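(* Let $R$ be a finite chain ring of length $2$ with residue field $\mathbb{F}_q$, where $q\ge5$ is a prime power. Then $$\mathrm{m}_3(R)\le\begin{cases}2q^2-2q+4 & \text{if } q \text{ is odd},\\ 2q^2-q+4 & \text{if } q \text{ is even}.\end{cases}$$
   Context: Throughout, $R$ is a finite chain ring of nilpotency index (length) $2$, i.e. a finite local ring with radical $\mathrm{rad}R\neq 0$, $(\mathrm{rad}R)^2=0$, whose one-sided ideals form the chain $R\supsetneq\mathrm{rad}R\supsetneq 0$, with residue field $R/\mathrm{rad}R\cong\mathbb{F}_q$ ($q$ a prime power); then $|R|=q^2$. The projective Hjelmslev plane $\mathrm{PHG}(2,R)$ is the incidence structure whose points are the free rank-$1$ submodules of the right module $R_R^3$, whose lines are the free rank-$2$ submodules of $R_R^3$, with incidence given by inclusion; it has $q^4+q^3+q^2$ points and each line contains $q^2+q$ points. A $(k,n)$-arc is a map $\mathcal{K}$ from the point set to $\mathbb{N}_0$ with $\sum_x\mathcal{K}(x)=k$ and $\sum_{x\in L}\mathcal{K}(x)\le n$ for every line $L$; it is projective if $\mathcal{K}$ takes only values in $\{0,1\}$ (i.e. it is a set of $k$ points meeting every line in at most $n$ points). For $0\le n\le q^2+q$, $\mathrm{m}_n(R)$ denotes the largest $k$ such that a projective $(k,n)$-arc exists in $\mathrm{PHG}(2,R)$. *)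

theory Defs
  imports Main
begin

definition right_ideal :: "'r::ring_1 set \<Rightarrow> bool" where
  "right_ideal I \<longleftrightarrow> 0 \<in> I \<and> (\<forall>a\<in>I. \<forall>b\<in>I. a + b \<in> I) \<and> (\<forall>a\<in>I. - a \<in> I)
     \<and> (\<forall>a\<in>I. \<forall>r. a * r \<in> I)"

definition left_ideal :: "'r::ring_1 set \<Rightarrow> bool" where
  "left_ideal I \<longleftrightarrow> 0 \<in> I \<and> (\<forall>a\<in>I. \<forall>b\<in>I. a + b \<in> I) \<and> (\<forall>a\<in>I. - a \<in> I)
     \<and> (\<forall>a\<in>I. \<forall>r. r * a \<in> I)"

text \<open>The ring (the type 'r) is a chain ring of length 2 with radical N:
  the one-sided ideals form the chain R > N > 0, and N^2 = 0.
  (Then N is the radical, the unique maximal one-sided ideal.)\<close>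

definition chain_ring2 :: "'r::{ring_1,finite} set \<Rightarrow> bool" where
  "chain_ring2 N \<longleftrightarrow> N \<noteq> UNIV \<and> N \<noteq> {0}
     \<and> {I. left_ideal I} = {UNIV, N, {0}}
     \<and> {I. right_ideal I} = {UNIV, N, {0}}
     \<and> (\<forall>a\<in>N. \<forall>b\<in>N. a * b = 0)"

type_synonym 'r vec3 = "'r \<times> 'r \<times> 'r"

definition vadd :: "'r::ring_1 vec3 \<Rightarrow> 'r vec3 \<Rightarrow> 'r vec3" where
  "vadd x y = (fst x + fst y, fst (snd x) + fst (snd y), snd (snd x) + snd (snd y))"

definition vsmul :: "'r::ring_1 vec3 \<Rightarrow> 'r \<Rightarrow> 'r vec3" where
  "vsmul x r = (fst x * r, fst (snd x) * r, snd (snd x) * r)"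

definition hpoints :: "('r::{ring_1,finite} vec3 set) set" where
  "hpoints = {M. \<exists>x. M = {vsmul x r | r. True} \<and> (\<forall>r. vsmul x r = (0,0,0) \<longrightarrow> r = 0)}"

definition hlines :: "('r::{ring_1,finite} vec3 set) set" where
  "hlines = {M. \<exists>x y. M = {vadd (vsmul x r) (vsmul y s) | r s. True}
      \<and> (\<forall>r s. vadd (vsmul x r) (vsmul y s) = (0,0,0) \<longrightarrow> r = 0 \<and> s = 0)}"

definition proj_arc :: "('r::{ring_1,finite} vec3 set) set \<Rightarrow> nat \<Rightarrow> bool" where
  "proj_arc K n \<longleftrightarrow> K \<subseteq> hpoints
     \<and> (\<forall>L\<in>(hlines :: ('r vec3 set) set). card {P\<in>K. P \<subseteq> L} \<le> n)"

definition m_arc :: "nat \<Rightarrow> 'r::{ring_1,finite} itself \<Rightarrow> nat" where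
  "m_arc n _ = Max {card K | K. proj_arc (K :: ('r vec3 set) set) n}"

end

theory Submission
  imports Defs "HOL-Library.Product_Plus"
begin

text \<open>
  Let \<open>X\<close> be a neighbour class of points and \<open>L\<close> a neighbour class of lines through it. If \<open>e + 1\<close>
  is the largest number of arc points on a segment of \<open>X\<close> in the direction \<open>L\<close>, the \<open>q\<close> lines of
  \<open>L\<close> through that segment cover the other point classes on \<open>L\<close>, which therefore carry at most
  \<open>q (2 - e)\<close> arc points. Summing over the \<open>q + 1\<close> directions gives the bound as soon as some class
  has at least four arc points, because these determine many directions; the parity of \<open>q\<close> enters
  through parallelograms with parallel diagonals, which do not exist for odd \<open>q\<close>.

  If all classes have at most three arc points, a segment with two or more of them makes its whole
  line class light, and no two point classes can do this for the same line class. Counting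
  incidences with all line classes then settles the case \<open>3 dvd q\<close>. If \<open>3\<close> does not divide \<open>q\<close>, a
  line class in which every segment has at most one arc point is a \<open>(k, 3)\<close>-arc in a projective
  plane of order \<open>q\<close>, and counting bisecants modulo three shows \<open>k \<le> 2 q + 1\<close>. This leaves only
  \<open>q = 5\<close> with at most two arc points per class, where the second moment of the line class weights
  gives a contradiction.
\<close>

section \<open>Double counting\<close>

lemma sum_card_eq_card_if_ex1:
  assumes "finite A" "finite B" "\<And>b. b \<in> B \<Longrightarrow> \<exists>!a. a \<in> A \<and> R a b"
  shows "(\<Sum>a\<in>A. card {b \<in> B. R a b}) = card B"
proof -
  have "card {a \<in> A. R a b} = 1" if "b \<in> B" for b
    using assms(3)[OF that] by (auto simp: card_1_singleton_iff set_eq_iff)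
  then have "(\<Sum>a\<in>A. card {b \<in> B. R a b}) = (\<Sum>b\<in>B. 1)"
    using assms(1,2) by (intro sum_multicount_gen) auto
  then show ?thesis by simp
qed

definition companions :: "('a \<Rightarrow> 'a \<Rightarrow> bool) \<Rightarrow> 'a set \<Rightarrow> 'a \<Rightarrow> 'a set" where
  "companions r A x = {y \<in> A - {x}. r x y}"

lemma finite_companions: "finite A \<Longrightarrow> finite (companions r A x)"
  unfolding companions_def by simp

lemma even_sum_card_companions:
  assumes "finite A" "\<And>x y. \<lbrakk>x \<in> A; y \<in> A; r x y\<rbrakk> \<Longrightarrow> r y x"
  shows "even (\<Sum>x\<in>A. card (companions r A x))"
  using assms
proof (induction A rule: finite_induct)
  case (insert a A)
  have companions_of_old: "card (companions r (insert a A) x)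
      = card (companions r A x) + of_bool (r a x)" if "x \<in> A" for x
  proof -
    have "companions r (insert a A) x = (if r a x then insert a else id) (companions r A x)"
      using that insert.hyps insert.prems unfolding companions_def by auto
    moreover have "a \<notin> companions r A x" using insert.hyps unfolding companions_def by simp
    ultimately show ?thesis using insert.hyps(1) finite_companions[of A r x] by simp
  qed
  have "companions r (insert a A) a = {x \<in> A. r a x}"
    using insert.hyps unfolding companions_def by auto
  then have "card (companions r (insert a A) a) = (\<Sum>x\<in>A. of_bool (r a x))"
    using insert.hyps(1) by (simp add: Int_def)
  then have "(\<Sum>x\<in>insert a A. card (companions r (insert a A) x))
      = 2 * (\<Sum>x\<in>A. of_bool (r a x)) + (\<Sum>x\<in>A. card (companions r A x))"
    using insert.hyps companions_of_old by (simp add: sum.distrib)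
  then show ?case using insert.IH insert.prems by simp
qed simp

section \<open>Arcs in projective planes\<close>

locale finite_projective_plane =
  fixes points :: "'p set" and lines :: "'l set" and inc :: "'p \<Rightarrow> 'l \<Rightarrow> bool" and q :: nat
  assumes finite_points: "finite points" and finite_lines: "finite lines"
    and points_nonempty: "points \<noteq> {}"
    and join: "\<lbrakk>p \<in> points; p' \<in> points; p \<noteq> p'\<rbrakk> \<Longrightarrow> \<exists>!l. l \<in> lines \<and> inc p l \<and> inc p' l"
    and meet: "\<lbrakk>l \<in> lines; l' \<in> lines; l \<noteq> l'\<rbrakk> \<Longrightarrow> \<exists>p\<in>points. inc p l \<and> inc p l'"
    and card_lines_through: "p \<in> points \<Longrightarrow> card {l \<in> lines. inc p l} = q + 1"
    and point_off_line: "l \<in> lines \<Longrightarrow> \<exists>p\<in>points. \<not> inc p l"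
begin

abbreviation pencil :: "'p \<Rightarrow> 'l set" where
  "pencil p \<equiv> {l \<in> lines. inc p l}"

lemma meet_unique:
  assumes "l \<in> lines" "l' \<in> lines" "l \<noteq> l'"
  shows "\<exists>!p. p \<in> points \<and> inc p l \<and> inc p l'"
  using meet[OF assms] join assms by blast

lemma order_pos: "q > 0"
proof (rule ccontr)
  assume "\<not> ?thesis"
  then have one_line: "card (pencil p) = 1" if "p \<in> points" for p
    using card_lines_through[OF that] by simp
  obtain p where "p \<in> points" using points_nonempty by blast
  then obtain l where pencil_p: "pencil p = {l}"
    using one_line card_1_singletonE by metis
  then obtain p' where p': "p' \<in> points" "\<not> inc p' l" using point_off_line by blast
  have "p \<noteq> p'" using pencil_p p'(2) by auto
  then obtain m where "m \<in> lines" "inc p m" "inc p' m"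
    using join[OF \<open>p \<in> points\<close> p'(1)] by blast
  then show False using pencil_p p'(2) by auto
qed

lemma card_points_on_line:
  assumes "l \<in> lines"
  shows "card {p \<in> points. inc p l} = q + 1"
proof -
  obtain p where p: "p \<in> points" "\<not> inc p l" using point_off_line[OF assms] by blast
  let ?range = "{x \<in> points. inc x l}"
  have "(\<Sum>x\<in>?range. card {m \<in> pencil p. inc x m}) = card (pencil p)"
  proof (rule sum_card_eq_card_if_ex1)
    fix m assume "m \<in> pencil p"
    then show "\<exists>!x. x \<in> ?range \<and> inc x m" using meet_unique[OF assms, of m] p(2) by auto
  qed (use finite_points finite_lines in auto)
  moreover have "card {m \<in> pencil p. inc x m} = 1" if "x \<in> ?range" for x
  proof -
    have "\<exists>!m. m \<in> lines \<and> inc p m \<and> inc x m" using join[OF p(1), of x] that p(2) by auto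
    then show ?thesis by (auto simp: card_1_singleton_iff set_eq_iff)
  qed
  ultimately show ?thesis using card_lines_through[OF p(1)] by simp
qed

lemma sum_pencil_card:
  assumes "p \<in> points" "S \<subseteq> points"
  shows "(\<Sum>l\<in>pencil p. card {x \<in> S. inc x l}) = card S + q * of_bool (p \<in> S)"
proof -
  have finite_S: "finite S" using assms(2) finite_points finite_subset by blast
  have "(\<Sum>l\<in>pencil p. card {x \<in> S - {p}. inc x l}) = card (S - {p})"
  proof (rule sum_card_eq_card_if_ex1)
    fix x assume "x \<in> S - {p}"
    then show "\<exists>!l. l \<in> pencil p \<and> inc x l" using join[OF assms(1), of x] assms(2) by auto
  qed (use finite_S finite_lines in auto)
  moreover have "card {x \<in> S. inc x l} = card {x \<in> S - {p}. inc x l} + of_bool (p \<in> S)"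
    if "l \<in> pencil p" for l
  proof -
    have "{x \<in> S. inc x l} = (if p \<in> S then insert p else id) {x \<in> S - {p}. inc x l}"
      using that by auto
    then show ?thesis using finite_S by simp
  qed
  moreover have "card S = card (S - {p}) + of_bool (p \<in> S)"
    using card_Suc_Diff1[OF finite_S, of p] by (cases "p \<in> S") auto
  ultimately show ?thesis using card_lines_through[OF assms(1)] by (simp add: sum.distrib)
qed

lemma card_points: "card points = q^2 + q + 1"
proof -
  obtain p where p: "p \<in> points" using points_nonempty by blast
  have "(q + 1) * (q + 1) = card points + q"
    using sum_pencil_card[OF p order_refl] card_points_on_line card_lines_through[OF p] p by simp
  then show ?thesis by (simp add: power2_eq_square)
qed

lemma card_lines: "card lines = q^2 + q + 1"
proof -
  have "(\<Sum>l\<in>lines. card {p \<in> points. inc p l}) = (\<Sum>p\<in>points. q + 1)"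
    by (rule sum_multicount_gen) (use finite_points finite_lines card_lines_through in auto)
  then have "card lines * (q + 1) = card points * (q + 1)" using card_points_on_line by simp
  then have "card lines = card points" by (simp only: mult_right_cancel)
  then show ?thesis using card_points by simp
qed

definition secants :: "'p set \<Rightarrow> nat \<Rightarrow> 'l set" where
  "secants S i = {l \<in> lines. card {p \<in> S. inc p l} = i}"

lemma finite_secants: "finite (secants S i)"
  unfolding secants_def using finite_lines by simp

context
  fixes S :: "'p set"
  assumes S_subset: "S \<subseteq> points"
    and S_arc: "\<And>l. l \<in> lines \<Longrightarrow> card {p \<in> S. inc p l} \<le> 3"
    and card_S: "card S = 2 * q + 2"
begin

lemma finite_S: "finite S"
  using S_subset finite_points finite_subset by blast

text \<open>The deficiencies \<^term>\<open>3 - card {x \<in> S. inc x l}\<close> of the lines \<^term>\<open>l\<close> through a point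
  of \<^term>\<open>S\<close> add up to one.\<close>

lemma bisecant_trisecant_pencil:
  assumes "p \<in> S"
  obtains l where "l \<in> secants S 2" "inc p l"
    "\<And>m. \<lbrakk>m \<in> lines; inc p m; m \<noteq> l\<rbrakk> \<Longrightarrow> m \<in> secants S 3"
proof -
  have p: "p \<in> points" using assms S_subset by blast
  let ?on = "\<lambda>l. card {x \<in> S. inc x l}"
  have "(\<Sum>l\<in>pencil p. 3 - ?on l) + (\<Sum>l\<in>pencil p. ?on l) = (\<Sum>l\<in>pencil p. 3)"
    unfolding sum.distrib[symmetric] by (rule sum.cong) (use S_arc in auto)
  then have "(\<Sum>l\<in>pencil p. 3 - ?on l) = 1"
    using sum_pencil_card[OF p S_subset] assms card_S card_lines_through[OF p] by simp
  then obtain l where l: "l \<in> pencil p" "3 - ?on l = 1"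
    and others: "\<forall>m\<in>pencil p. l \<noteq> m \<longrightarrow> 3 - ?on m = 0"
    using finite_lines by (subst (asm) sum_eq_1_iff) auto
  have "?on l = 2" using l(2) by linarith
  show ?thesis
  proof (rule that[of l])
    show "l \<in> secants S 2" "inc p l" using l(1) \<open>?on l = 2\<close> unfolding secants_def by blast+
    show "m \<in> secants S 3" if "m \<in> lines" "inc p m" "m \<noteq> l" for m
      using others S_arc[of m] that unfolding secants_def by fastforce
  qed
qed

lemma bisecant_unique:
  assumes "p \<in> S"
  shows "\<exists>!l. l \<in> secants S 2 \<and> inc p l"
proof -
  obtain l where l: "l \<in> secants S 2" "inc p l"
    "\<And>m. \<lbrakk>m \<in> lines; inc p m; m \<noteq> l\<rbrakk> \<Longrightarrow> m \<in> secants S 3"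
    using bisecant_trisecant_pencil[OF assms] by metis
  have "m = l" if "m \<in> secants S 2" "inc p m" for m
    using l(3)[of m] that by (force simp: secants_def)
  then show ?thesis using l(1,2) by blast
qed

lemma secant_cases:
  assumes "l \<in> lines"
  shows "l \<in> secants S 0 \<union> secants S 2 \<union> secants S 3"
proof (cases "\<exists>p\<in>S. inc p l")
  case True
  then show ?thesis using assms bisecant_trisecant_pencil by blast
next
  case False
  then have "{p \<in> S. inc p l} = {}" by blast
  then have "card {p \<in> S. inc p l} = 0" by (simp only: card.empty)
  then show ?thesis using assms unfolding secants_def by simp
qed

lemma card_bisecants: "card (secants S 2) = q + 1"
proof -
  have "(\<Sum>l\<in>secants S 2. card {p \<in> S. inc p l}) = card S"
    by (rule sum_card_eq_card_if_ex1[OF finite_secants finite_S bisecant_unique])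
  moreover have "(\<Sum>l\<in>secants S 2. card {p \<in> S. inc p l}) = (\<Sum>l\<in>secants S 2. 2)"
    by (rule sum.cong) (auto simp: secants_def)
  ultimately show ?thesis using card_S by simp
qed

lemma card_bisecants_through_mod_3:
  assumes "p \<in> points" "p \<notin> S"
  shows "card {l \<in> secants S 2. inc p l} mod 3 = (q + 1) mod 3"
proof -
  let ?on = "\<lambda>l. card {x \<in> S. inc x l}"
  have "?on l = 2 * of_bool (l \<in> secants S 2) + 3 * of_bool (l \<in> secants S 3)"
    if "l \<in> pencil p" for l
    using secant_cases[of l] that by (auto simp: secants_def)
  then have "2 * card {l \<in> pencil p. l \<in> secants S 2} + 3 * card {l \<in> pencil p. l \<in> secants S 3}
      = 2 * (q + 1)"
    using sum_pencil_card[OF assms(1) S_subset] assms(2) card_S finite_lines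
    by (simp add: sum.distrib sum_distrib_left[symmetric] Int_def)
  moreover have "{l \<in> pencil p. l \<in> secants S 2} = {l \<in> secants S 2. inc p l}"
    by (auto simp: secants_def)
  ultimately have "2 * card {l \<in> secants S 2. inc p l} + 3 * card {l \<in> pencil p. l \<in> secants S 3}
      = 2 * (q + 1)"
    by (simp only:)
  moreover have "b mod 3 = n mod 3" if "2 * b + 3 * t = 2 * n" for b t n :: nat
  proof -
    have "even (2 * b + 3 * t)" unfolding that by simp
    then obtain s where "t = 2 * s" by (auto elim!: evenE)
    then have "n = b + 3 * s" using that by simp
    then show ?thesis by simp
  qed
  ultimately show ?thesis by blast
qed

lemma sum_bisecants_meeting_bisecant:
  assumes "l \<in> secants S 2"
  shows "(\<Sum>p\<in>{p \<in> points - S. inc p l}. card {m \<in> secants S 2 - {l}. inc p m}) = q"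
proof -
  have "\<exists>!p. p \<in> {p \<in> points - S. inc p l} \<and> inc p m" if "m \<in> secants S 2 - {l}" for m
  proof -
    have distinct_lines: "m \<in> secants S 2" "l \<in> lines" "m \<in> lines" "l \<noteq> m"
      using that assms by (auto simp: secants_def)
    have "p \<notin> S" if "inc p l" "inc p m" for p
      using bisecant_unique[of p] assms distinct_lines(1,4) that by blast
    then show ?thesis using meet_unique[OF distinct_lines(2-4)] by auto
  qed
  then have "(\<Sum>p\<in>{p \<in> points - S. inc p l}. card {m \<in> secants S 2 - {l}. inc p m})
      = card (secants S 2 - {l})"
    by (intro sum_card_eq_card_if_ex1) (auto simp: finite_secants finite_points)
  then show ?thesis using card_bisecants assms finite_secants by simp
qed

lemma card_bisecant_minus_arc:
  assumes "l \<in> secants S 2"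
  shows "card {p \<in> points - S. inc p l} = q - 1"
proof -
  have "{p \<in> points - S. inc p l} = {p \<in> points. inc p l} - {p \<in> S. inc p l}" by auto
  moreover have "{p \<in> S. inc p l} \<subseteq> {p \<in> points. inc p l}" using S_subset by auto
  ultimately show ?thesis
    using assms finite_S card_points_on_line[of l] by (simp add: secants_def card_Diff_subset)
qed

lemma card_other_bisecants_mod_3:
  assumes "l \<in> secants S 2" "p \<in> points - S" "inc p l"
  shows "card {m \<in> secants S 2 - {l}. inc p m} mod 3 = q mod 3"
proof -
  have "{m \<in> secants S 2. inc p m} = insert l {m \<in> secants S 2 - {l}. inc p m}"
    using assms by auto
  then have "(card {m \<in> secants S 2 - {l}. inc p m} + 1) mod 3 = (q + 1) mod 3"
    using card_bisecants_through_mod_3[of p] assms(2) finite_secants by simp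
  then show ?thesis by (simp add: mod_Suc split: if_splits)
qed

text \<open>On a bisecant there are \<^term>\<open>q - 1\<close> points outside \<^term>\<open>S\<close>, and the other \<^term>\<open>q\<close>
  bisecants are distributed among them with multiplicities congruent to \<^term>\<open>q\<close> modulo three.\<close>

lemma three_dvd_order_if_card_arc: "3 dvd q \<or> q = 2"
proof -
  have "secants S 2 \<noteq> {}" using card_bisecants by force
  then obtain l where l: "l \<in> secants S 2" by blast
  let ?free = "{p \<in> points - S. inc p l}"
  let ?others = "\<lambda>p. card {m \<in> secants S 2 - {l}. inc p m}"
  note card_free = card_bisecant_minus_arc[OF l]
  have others_mod: "?others p mod 3 = q mod 3" if "p \<in> ?free" for p
    using card_other_bisecants_mod_3[OF l] that by simp
  have sum_others: "sum ?others ?free = q" by (rule sum_bisecants_meeting_bisecant[OF l])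
  consider (zero) "q mod 3 = 0" | (one) "q mod 3 = 1" | (two) "q mod 3 = 2" by linarith
  then show ?thesis
  proof cases
    case zero
    then show ?thesis by auto
  next
    case one
    have "q mod 3 = (\<Sum>p\<in>?free. ?others p mod 3) mod 3"
      by (simp only: mod_sum_eq sum_others)
    also have "\<dots> = (\<Sum>p\<in>?free. 1) mod 3"
      using others_mod one by (intro arg_cong[where f = "\<lambda>n. n mod 3"] sum.cong) simp_all
    also have "\<dots> = (q - 1) mod 3" using card_free by simp
    finally have "q mod 3 = (q - 1) mod 3" .
    moreover have "3 dvd q - 1" using dvd_minus_mod[of 3 q] one by simp
    ultimately show ?thesis using one by simp
  next
    case two
    have "2 \<le> ?others p" if "p \<in> ?free" for p
      using others_mod[OF that] two mod_less_eq_dividend[of "?others p" 3] by simp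
    then have "card ?free * 2 \<le> sum ?others ?free"
      using sum_bounded_below[of ?free 2 ?others] by simp
    then have "q \<le> 2" unfolding sum_others card_free by simp
    moreover have "q \<noteq> 0" "q \<noteq> 1" using two by auto
    ultimately show ?thesis by linarith
  qed
qed

end

theorem card_arc_of_degree_3_le:
  assumes "S \<subseteq> points" "\<And>l. l \<in> lines \<Longrightarrow> card {p \<in> S. inc p l} \<le> 3"
    and "\<not> 3 dvd q" "q \<noteq> 2"
  shows "card S \<le> 2 * q + 1"
proof (rule ccontr)
  assume "\<not> ?thesis"
  then have "2 * q + 2 \<le> card S" by simp
  then obtain T where T: "T \<subseteq> S" "card T = 2 * q + 2" by (rule obtain_subset_with_card_n)
  have "finite S" using assms(1) finite_points finite_subset by blast
  then have "card {p \<in> T. inc p l} \<le> card {p \<in> S. inc p l}" for l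
    using T(1) by (intro card_mono) auto
  then have "card {p \<in> T. inc p l} \<le> 3" if "l \<in> lines" for l
    using assms(2)[OF that] by (meson order_trans)
  then show False using three_dvd_order_if_card_arc[of T] T assms(1,3,4) by blast
qed

end

section \<open>Point sets and their directions\<close>

definition excess :: "('a \<Rightarrow> 'a \<Rightarrow> bool) \<Rightarrow> 'a set \<Rightarrow> nat" where
  "excess r A = Max (insert 0 ((\<lambda>x. card (companions r A x)) ` A))"

lemma card_companions_le_excess:
  assumes "finite A" "x \<in> A"
  shows "card (companions r A x) \<le> excess r A"
  unfolding excess_def using assms by (intro Max_ge) auto

lemma excess_attained:
  assumes "finite A" "A \<noteq> {}"
  obtains x where "x \<in> A" "excess r A = card (companions r A x)"
proof -
  have "excess r A \<in> insert 0 ((\<lambda>x. card (companions r A x)) ` A)"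
    unfolding excess_def using assms(1) by (intro Max_in) auto
  moreover have "excess r A = card (companions r A x)" if "excess r A = 0" "x \<in> A" for x
    using card_companions_le_excess[OF assms(1) that(2), of r] that(1) by simp
  ultimately show ?thesis using assms(2) that by blast
qed

text \<open>A parallelogram with parallel diagonals: its diagonal points lie on the line at infinity, as
  in the Fano plane.\<close>

definition fano_quadrangle ::
  "('d \<Rightarrow> 'a \<Rightarrow> 'a \<Rightarrow> bool) \<Rightarrow> 'd \<Rightarrow> 'd \<Rightarrow> 'd \<Rightarrow> 'a \<Rightarrow> 'a \<Rightarrow> 'a \<Rightarrow> 'a \<Rightarrow> bool" where
  "fano_quadrangle par L M H a b c d \<longleftrightarrow> distinct [L, M, H] \<and> distinct [a, b, c, d]
     \<and> par L a b \<and> par L c d \<and> par M a c \<and> par M b d \<and> par H a d \<and> par H b c"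

locale direction_system =
  fixes A :: "'a set" and dirs :: "'d set" and par :: "'d \<Rightarrow> 'a \<Rightarrow> 'a \<Rightarrow> bool"
  assumes finite_A: "finite A" and finite_dirs: "finite dirs"
    and par_sym: "\<lbrakk>d \<in> dirs; x \<in> A; y \<in> A; par d x y\<rbrakk> \<Longrightarrow> par d y x"
    and par_trans: "\<lbrakk>d \<in> dirs; x \<in> A; y \<in> A; z \<in> A; par d x y; par d y z\<rbrakk> \<Longrightarrow> par d x z"
    and unique_direction: "\<lbrakk>x \<in> A; y \<in> A; x \<noteq> y\<rbrakk> \<Longrightarrow> \<exists>!d. d \<in> dirs \<and> par d x y"
begin

lemma sum_card_companions:
  assumes "x \<in> A"
  shows "(\<Sum>d\<in>dirs. card (companions (par d) A x)) = card A - 1"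
proof -
  have "(\<Sum>d\<in>dirs. card {y \<in> A - {x}. par d x y}) = card (A - {x})"
    using finite_A finite_dirs by (intro sum_card_eq_card_if_ex1 unique_direction[OF assms]) auto
  then show ?thesis unfolding companions_def using assms by simp
qed

definition total_excess :: nat where
  "total_excess = (\<Sum>d\<in>dirs. excess (par d) A)"

lemma card_le_total_excess: "card A - 1 \<le> total_excess"
proof (cases "A = {}")
  case False
  then obtain x where "x \<in> A" by blast
  then show ?thesis unfolding total_excess_def sum_card_companions[symmetric, OF \<open>x \<in> A\<close>]
    by (intro sum_mono card_companions_le_excess finite_A)
qed simp

text \<open>A point outside a longest segment of direction \<^term>\<open>d\<close> has to meet all points of that
  segment in other directions.\<close>

lemma twice_excess_less_total_excess:
  assumes "d \<in> dirs" "excess (par d) A + 1 < card A"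
  shows "2 * excess (par d) A < total_excess"
proof -
  let ?seg = "\<lambda>x. companions (par d) A x"
  have "A \<noteq> {}" using assms(2) by auto
  then obtain p where p: "p \<in> A" "excess (par d) A = card (?seg p)"
    by (rule excess_attained[OF finite_A])
  have "card (insert p (?seg p)) < card A"
    using p(2) assms(2) finite_companions[OF finite_A] by (simp add: companions_def)
  then have "\<not> A \<subseteq> insert p (?seg p)"
    using card_mono[of "insert p (?seg p)" A] finite_companions[OF finite_A] by fastforce
  then obtain r where r: "r \<in> A" "r \<noteq> p" "\<not> par d p r" by (auto simp: companions_def)
  have "insert p (?seg p) \<inter> insert r (?seg r) = {}"
    using r p(1) assms(1) par_sym par_trans unfolding companions_def by blast
  then have "card (insert p (?seg p)) + card (insert r (?seg r))
      = card (insert p (?seg p) \<union> insert r (?seg r))"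
    using finite_companions[OF finite_A] by (intro card_Un_disjoint[symmetric]) auto
  also have "\<dots> \<le> card A"
    using p(1) r(1) finite_A by (intro card_mono) (auto simp: companions_def)
  finally have "card (?seg p) + card (?seg r) + 2 \<le> card A"
    using finite_companions[OF finite_A] by (simp add: companions_def)
  moreover have "card A - 1 = card (?seg r) + (\<Sum>c\<in>dirs - {d}. card (companions (par c) A r))"
    using sum_card_companions[OF r(1)] sum.remove[OF finite_dirs assms(1)] by metis
  moreover have "(\<Sum>c\<in>dirs - {d}. card (companions (par c) A r))
      \<le> (\<Sum>c\<in>dirs - {d}. excess (par c) A)"
    by (intro sum_mono card_companions_le_excess finite_A r(1))
  moreover have "total_excess = excess (par d) A + (\<Sum>c\<in>dirs - {d}. excess (par c) A)"
    unfolding total_excess_def using sum.remove[OF finite_dirs assms(1)] by blast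
  ultimately show ?thesis using p(2) by linarith
qed

lemma card_le_total_excess_if_odd:
  assumes "odd (card A)" "card A \<noteq> 1" "\<And>d. d \<in> dirs \<Longrightarrow> excess (par d) A \<le> 1"
  shows "card A \<le> total_excess"
proof -
  have "(\<Sum>x\<in>A. card (companions (par d) A x)) \<le> (card A - 1) * excess (par d) A"
    if d: "d \<in> dirs" for d
  proof -
    let ?pairs = "\<Sum>x\<in>A. card (companions (par d) A x)"
    have "?pairs \<le> card A * excess (par d) A"
      using sum_bounded_above[of A _ "excess (par d) A"] card_companions_le_excess[OF finite_A]
      by simp
    moreover have "even ?pairs" by (rule even_sum_card_companions[OF finite_A par_sym[OF d]])
    then have "?pairs \<noteq> card A" using assms(1) by metis
    moreover have "excess (par d) A = 0 \<or> excess (par d) A = 1" using assms(3)[OF d] by linarith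
    ultimately show ?thesis by auto
  qed
  then have "(\<Sum>d\<in>dirs. \<Sum>x\<in>A. card (companions (par d) A x))
      \<le> (\<Sum>d\<in>dirs. (card A - 1) * excess (par d) A)"
    by (rule sum_mono)
  moreover have "(\<Sum>d\<in>dirs. \<Sum>x\<in>A. card (companions (par d) A x)) = card A * (card A - 1)"
    unfolding sum.swap[of _ A dirs] using sum_card_companions by simp
  ultimately have "(card A - 1) * card A \<le> (card A - 1) * total_excess"
    unfolding total_excess_def sum_distrib_left by (simp add: mult.commute)
  then show ?thesis using assms(1,2) by (auto elim: oddE)
qed

lemma card_companions_eq_excess_if_total_excess_le:
  assumes "total_excess \<le> card A - 1" "d \<in> dirs" "x \<in> A"
  shows "card (companions (par d) A x) = excess (par d) A"
proof (rule ccontr)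
  assume "\<not> ?thesis"
  then have "card (companions (par d) A x) < excess (par d) A"
    using card_companions_le_excess[OF finite_A assms(3), of "par d"] by simp
  then have "(\<Sum>c\<in>dirs. card (companions (par c) A x)) < (\<Sum>c\<in>dirs. excess (par c) A)"
    using assms(2) card_companions_le_excess[OF finite_A assms(3)] finite_dirs
    by (intro sum_strict_mono_ex1) auto
  then show False
    using sum_card_companions[OF assms(3)] assms(1) unfolding total_excess_def by simp
qed

definition perfect_matching :: "'d \<Rightarrow> bool" where
  "perfect_matching d \<longleftrightarrow> d \<in> dirs \<and> (\<forall>x\<in>A. card (companions (par d) A x) = 1)"

lemma perfect_matching_partner:
  assumes "perfect_matching d" "x \<in> A"
  obtains y where "y \<in> A" "y \<noteq> x" "par d x y"
proof -
  obtain y where "companions (par d) A x = {y}"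
    using assms card_1_singletonE unfolding perfect_matching_def by metis
  then show ?thesis using that[of y] unfolding companions_def by auto
qed

lemma perfect_matching_unique:
  assumes "perfect_matching d" "x \<in> A" "y \<in> A" "z \<in> A" "y \<noteq> x" "z \<noteq> x" "par d x y" "par d x z"
  shows "y = z"
proof -
  obtain u where "companions (par d) A x = {u}"
    using assms(1,2) card_1_singletonE unfolding perfect_matching_def by metis
  moreover have "{y, z} \<subseteq> companions (par d) A x" using assms unfolding companions_def by simp
  ultimately show ?thesis by auto
qed

lemma opposite_pair_parallel:
  assumes "perfect_matching L" "par L a b"
    and "A = {a, b, c, d}" "distinct [a, b, c, d]"
  shows "par L c d"
proof -
  have L_dir: "L \<in> dirs" using assms(1) unfolding perfect_matching_def by blast
  have in_A: "a \<in> A" "b \<in> A" "c \<in> A" using assms(3) by auto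
  obtain y where y: "y \<in> A" "y \<noteq> c" "par L c y"
    using perfect_matching_partner[OF assms(1) in_A(3)] by blast
  have y_par_c: "par L y c" by (rule par_sym[OF L_dir in_A(3) y(1,3)])
  have "y \<noteq> a"
    using perfect_matching_unique[OF assms(1), of a b c] in_A assms(2,4) y_par_c by auto
  moreover have "y \<noteq> b"
    using perfect_matching_unique[OF assms(1), of b a c] par_sym[OF L_dir, of a b]
      in_A assms(2,4) y_par_c
    by auto
  ultimately show ?thesis using y assms(3) by auto
qed

lemma perfect_matching_if_total_excess_less:
  assumes "card A = 4" "total_excess < 4" "\<And>d. d \<in> dirs \<Longrightarrow> excess (par d) A \<le> 2"
    and "d \<in> dirs" "x \<in> A" "y \<in> A" "x \<noteq> y" "par d x y"
  shows "perfect_matching d"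
proof -
  have companions_eq: "card (companions (par d) A z) = excess (par d) A" if "z \<in> A" for z
    using card_companions_eq_excess_if_total_excess_le[OF _ assms(4) that] assms(1,2) by simp
  have "y \<in> companions (par d) A x" using assms unfolding companions_def by simp
  then have "card (companions (par d) A x) \<noteq> 0" using finite_companions[OF finite_A] by auto
  moreover have "excess (par d) A \<le> 1"
    using twice_excess_less_total_excess[OF assms(4)] assms(3)[OF assms(4)] assms(1,2) by linarith
  ultimately have "excess (par d) A = 1" using companions_eq[OF assms(5)] by simp
  then show ?thesis unfolding perfect_matching_def using companions_eq assms(4) by simp
qed

lemma fano_quadrangle_if_total_excess_less:
  assumes "card A = 4" "total_excess < 4" "\<And>d. d \<in> dirs \<Longrightarrow> excess (par d) A \<le> 2"
  shows "\<exists>L\<in>dirs. \<exists>M\<in>dirs. \<exists>H\<in>dirs. \<exists>a\<in>A. \<exists>b\<in>A. \<exists>c\<in>A. \<exists>d\<in>A. fano_quadrangle par L M H a b c d"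
proof -
  obtain a b c d where A_eq: "A = {a, b, c, d}" and dist: "distinct [a, b, c, d]"
    using assms(1) by (auto simp: card_Suc_eq numeral_eq_Suc)
  have in_A: "a \<in> A" "b \<in> A" "c \<in> A" "d \<in> A" using A_eq by auto
  have matching: "perfect_matching N" if "N \<in> dirs" "par N a x" "x \<in> A" "x \<noteq> a" for N x
    by (rule perfect_matching_if_total_excess_less[of N a x]) (use assms in_A that in auto)
  obtain L where L: "L \<in> dirs" "par L a b" using unique_direction[of a b] in_A dist by auto
  obtain M where M: "M \<in> dirs" "par M a c" using unique_direction[of a c] in_A dist by auto
  obtain H where H: "H \<in> dirs" "par H a d" using unique_direction[of a d] in_A dist by auto
  have matchings: "perfect_matching L" "perfect_matching M" "perfect_matching H"
    using matching[OF L in_A(2)] matching[OF M in_A(3)] matching[OF H in_A(4)] dist by auto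
  have "par L c d"
    by (rule opposite_pair_parallel[OF matchings(1) L(2)]) (use A_eq dist in auto)
  moreover have "par M b d"
    by (rule opposite_pair_parallel[OF matchings(2) M(2)]) (use A_eq dist in auto)
  moreover have "par H b c"
    by (rule opposite_pair_parallel[OF matchings(3) H(2)]) (use A_eq dist in auto)
  moreover have "distinct [L, M, H]"
  proof -
    have "N \<noteq> N'" if "perfect_matching N" "par N a x" "par N' a y" "x \<in> A" "y \<in> A"
      "x \<noteq> a" "y \<noteq> a" "x \<noteq> y" for N N' x y
      using perfect_matching_unique[OF that(1) in_A(1), of x y] that by auto
    from this[OF matchings(1) L(2) M(2)] this[OF matchings(1) L(2) H(2)]
      this[OF matchings(2) M(2) H(2)] show ?thesis using in_A dist by auto
  qed
  ultimately have "fano_quadrangle par L M H a b c d"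
    unfolding fano_quadrangle_def using L M H dist by blast
  then show ?thesis using L(1) M(1) H(1) in_A by blast
qed

end

section \<open>Projective Hjelmslev planes\<close>

locale hjelmslev_plane =
  classes: finite_projective_plane point_classes line_classes class_inc q
  for point_classes :: "'x set" and line_classes :: "'y set"
    and class_inc :: "'x \<Rightarrow> 'y \<Rightarrow> bool" and q :: nat +
  fixes points :: "'p set" and class_of :: "'p \<Rightarrow> 'x"
    and lines_of :: "'y \<Rightarrow> 'l set" and inc :: "'p \<Rightarrow> 'l \<Rightarrow> bool"
  assumes finite_points: "finite points" and finite_lines_of: "finite (lines_of L)"
    and class_of_image: "class_of ` points = point_classes"
    and class_inc_if_inc: "\<lbrakk>L \<in> line_classes; l \<in> lines_of L; p \<in> points; inc p l\<rbrakk>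
      \<Longrightarrow> class_inc (class_of p) L"
    and card_lines_of_through: "\<lbrakk>L \<in> line_classes; p \<in> points; class_inc (class_of p) L\<rbrakk>
      \<Longrightarrow> card {l \<in> lines_of L. inc p l} = q"
    and line_join: "\<lbrakk>L \<in> line_classes; p \<in> points; p' \<in> points; class_inc (class_of p) L;
      class_inc (class_of p') L; class_of p \<noteq> class_of p'\<rbrakk>
      \<Longrightarrow> \<exists>!l. l \<in> lines_of L \<and> inc p l \<and> inc p' l"
    and line_meet: "\<lbrakk>L \<in> line_classes; l \<in> lines_of L; l' \<in> lines_of L; l \<noteq> l'\<rbrakk>
      \<Longrightarrow> \<exists>p\<in>points. inc p l \<and> inc p l'"
    and line_meets_class: "\<lbrakk>L \<in> line_classes; l \<in> lines_of L; X \<in> point_classes; class_inc X L\<rbrakk>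
      \<Longrightarrow> \<exists>p\<in>points. class_of p = X \<and> inc p l"
    and segment_transfer: "\<lbrakk>L \<in> line_classes; l \<in> lines_of L; l' \<in> lines_of L; p \<in> points;
      p' \<in> points; class_of p = class_of p'; inc p l; inc p' l; inc p l'\<rbrakk> \<Longrightarrow> inc p' l'"
    and unique_direction: "\<lbrakk>p \<in> points; p' \<in> points; class_of p = class_of p'; p \<noteq> p'\<rbrakk>
      \<Longrightarrow> \<exists>!L. L \<in> line_classes \<and> (\<exists>l\<in>lines_of L. inc p l \<and> inc p' l)"
begin

lemma class_of_in: "p \<in> points \<Longrightarrow> class_of p \<in> point_classes"
  using class_of_image by blast

definition same_segment :: "'y \<Rightarrow> 'p \<Rightarrow> 'p \<Rightarrow> bool" where
  "same_segment L p p' \<longleftrightarrow> class_of p = class_of p' \<and> (\<exists>l\<in>lines_of L. inc p l \<and> inc p' l)"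

lemma same_segment_sym: "same_segment L p p' \<Longrightarrow> same_segment L p' p"
  unfolding same_segment_def by auto

lemma inc_same_segment:
  "\<lbrakk>same_segment L p p'; L \<in> line_classes; p \<in> points; p' \<in> points; l \<in> lines_of L; inc p l\<rbrakk>
    \<Longrightarrow> inc p' l"
  unfolding same_segment_def using segment_transfer by blast

lemma same_segment_trans:
  "\<lbrakk>same_segment L p p'; same_segment L p' p''; L \<in> line_classes; p \<in> points; p' \<in> points;
    p'' \<in> points\<rbrakk> \<Longrightarrow> same_segment L p p''"
  unfolding same_segment_def by (metis segment_transfer)

definition fano_free :: bool where
  "fano_free \<longleftrightarrow> \<not> (\<exists>L\<in>line_classes. \<exists>M\<in>line_classes. \<exists>H\<in>line_classes.
    \<exists>a\<in>points. \<exists>b\<in>points. \<exists>c\<in>points. \<exists>d\<in>points. fano_quadrangle same_segment L M H a b c d)"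

lemma line_of_through:
  assumes "L \<in> line_classes" "p \<in> points" "class_inc (class_of p) L"
  obtains l where "l \<in> lines_of L" "inc p l"
proof -
  have "card {l \<in> lines_of L. inc p l} \<noteq> 0"
    using card_lines_of_through[OF assms] classes.order_pos by simp
  then have "{l \<in> lines_of L. inc p l} \<noteq> {}" by (metis card.empty)
  then show ?thesis using that by blast
qed

lemma same_segment_refl:
  "\<lbrakk>L \<in> line_classes; p \<in> points; class_inc (class_of p) L\<rbrakk> \<Longrightarrow> same_segment L p p"
  unfolding same_segment_def using line_of_through by metis

lemma direction_system_in_class:
  assumes "A \<subseteq> {p \<in> points. class_of p = X}"
  shows "direction_system A (classes.pencil X) same_segment"
proof
  show "finite A" using assms finite_points finite_subset by fastforce
  show "same_segment L x z"
    if "L \<in> classes.pencil X" "x \<in> A" "y \<in> A" "z \<in> A"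
      "same_segment L x y" "same_segment L y z" for L x y z
    using that assms same_segment_trans[of L x y z] by auto
  show "\<exists>!L. L \<in> classes.pencil X \<and> same_segment L x y"
    if "x \<in> A" "y \<in> A" "x \<noteq> y" for x y
  proof -
    have in_X: "x \<in> points" "y \<in> points" "class_of x = X" "class_of y = X" using that assms by auto
    then have "L \<in> classes.pencil X \<and> same_segment L x y
        \<longleftrightarrow> L \<in> line_classes \<and> (\<exists>l\<in>lines_of L. inc x l \<and> inc y l)" for L
      using class_inc_if_inc[of L _ x] unfolding same_segment_def by auto
    then show ?thesis using unique_direction[OF in_X(1,2)] in_X(3,4) that(3) by simp
  qed
qed (auto simp: same_segment_sym classes.finite_lines)

lemma sum_pencil_card_other_classes:
  assumes "L \<in> line_classes" "p \<in> points" "class_inc (class_of p) L" and "S \<subseteq> points"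
    and "\<And>x. x \<in> S \<Longrightarrow> class_inc (class_of x) L \<and> class_of x \<noteq> class_of p"
  shows "(\<Sum>l\<in>{l \<in> lines_of L. inc p l}. card {x \<in> S. inc x l}) = card S"
proof (rule sum_card_eq_card_if_ex1)
  show "finite S" using assms(4) finite_points finite_subset by blast
  show "\<exists>!l. l \<in> {l \<in> lines_of L. inc p l} \<and> inc x l" if "x \<in> S" for x
  proof -
    have "\<exists>!l. l \<in> lines_of L \<and> inc p l \<and> inc x l"
      using assms(4) assms(5)[OF that] that by (intro line_join[OF assms(1,2) _ assms(3)]) auto
    then show ?thesis by (simp add: conj_assoc)
  qed
qed (use finite_lines_of in auto)

subsection \<open>The projective plane of segments of a line class\<close>

text \<open>Adding a point at infinity to the segments of a line class \<^term>\<open>L\<close>, and the point classes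
  on \<^term>\<open>L\<close> to the lines in \<^term>\<open>L\<close>, gives a projective plane; the added lines are those
  through the added point.\<close>

definition segment :: "'y \<Rightarrow> 'p \<Rightarrow> 'p set" where
  "segment L p = {p' \<in> points. same_segment L p p'}"

definition segment_points :: "'y \<Rightarrow> 'p set option set" where
  "segment_points L =
    insert None ((\<lambda>p. Some (segment L p)) ` {p \<in> points. class_inc (class_of p) L})"

definition segment_lines :: "'y \<Rightarrow> ('l + 'x) set" where
  "segment_lines L = lines_of L <+> {X \<in> point_classes. class_inc X L}"

fun segment_inc :: "'p set option \<Rightarrow> 'l + 'x \<Rightarrow> bool" where
  "segment_inc None (Inl l) \<longleftrightarrow> False"
| "segment_inc None (Inr X) \<longleftrightarrow> True"
| "segment_inc (Some s) (Inl l) \<longleftrightarrow> (\<exists>p\<in>s. inc p l)"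
| "segment_inc (Some s) (Inr X) \<longleftrightarrow> (\<exists>p\<in>s. class_of p = X)"

context
  fixes L :: 'y
  assumes L: "L \<in> line_classes"
begin

lemma finite_segment_points: "finite (segment_points L)"
  unfolding segment_points_def using finite_points by simp

lemma finite_segment_lines: "finite (segment_lines L)"
  unfolding segment_lines_def using finite_lines_of classes.finite_points by simp

lemma segment_points_cases:
  assumes "s \<in> segment_points L"
  obtains (infinity) "s = None"
    | (segment) p where "p \<in> points" "class_inc (class_of p) L" "s = Some (segment L p)"
  using assms unfolding segment_points_def by auto

lemma segment_lines_cases:
  assumes "m \<in> segment_lines L"
  obtains (line) l where "l \<in> lines_of L" "m = Inl l"
    | (point_class) X where "X \<in> point_classes" "class_inc X L" "m = Inr X"
  using assms unfolding segment_lines_def by auto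

lemma ex1_segment_lines_Inl:
  assumes "\<exists>!l. l \<in> lines_of L \<and> P (Inl l)" "\<And>X. \<not> P (Inr X)"
  shows "\<exists>!m. m \<in> segment_lines L \<and> P m"
proof -
  obtain l where l: "l \<in> lines_of L" "P (Inl l)"
    and unique: "\<And>l'. \<lbrakk>l' \<in> lines_of L; P (Inl l')\<rbrakk> \<Longrightarrow> l' = l" using assms(1) by blast
  have "m = Inl l" if "m \<in> segment_lines L" "P m" for m
    using that(1) by (cases rule: segment_lines_cases) (use unique assms(2) that(2) in auto)
  then show ?thesis using l unfolding segment_lines_def by blast
qed

lemma ex1_segment_lines_Inr:
  assumes "X \<in> point_classes" "class_inc X L" "P (Inr X)"
    and "\<And>Y. P (Inr Y) \<Longrightarrow> Y = X" "\<And>l. l \<in> lines_of L \<Longrightarrow> \<not> P (Inl l)"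
  shows "\<exists>!m. m \<in> segment_lines L \<and> P m"
proof -
  have "m = Inr X" if "m \<in> segment_lines L" "P m" for m
    using that(1) by (cases rule: segment_lines_cases) (use assms(4,5) that(2) in auto)
  then show ?thesis using assms(1-3) unfolding segment_lines_def by blast
qed

context
  fixes p :: 'p
  assumes p: "p \<in> points" "class_inc (class_of p) L"
begin

lemma self_in_segment: "p \<in> segment L p"
  unfolding segment_def using same_segment_refl[OF L p] p(1) by blast

lemma segment_inc_segment_Inl:
  assumes "l \<in> lines_of L"
  shows "segment_inc (Some (segment L p)) (Inl l) \<longleftrightarrow> inc p l"
proof
  assume "segment_inc (Some (segment L p)) (Inl l)"
  then obtain p' where "p' \<in> points" "same_segment L p p'" "inc p' l"
    unfolding segment_def by auto
  then show "inc p l" using inc_same_segment[OF same_segment_sym L _ p(1) assms] by blast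
next
  assume "inc p l"
  then show "segment_inc (Some (segment L p)) (Inl l)" using self_in_segment by auto
qed

lemma segment_inc_segment_Inr: "segment_inc (Some (segment L p)) (Inr X) \<longleftrightarrow> class_of p = X"
proof
  assume "segment_inc (Some (segment L p)) (Inr X)"
  then show "class_of p = X" unfolding segment_def same_segment_def by auto
next
  assume "class_of p = X"
  then show "segment_inc (Some (segment L p)) (Inr X)" using self_in_segment by auto
qed

lemma card_segment_lines_through:
  "card {m \<in> segment_lines L. segment_inc (Some (segment L p)) m} = q + 1"
proof -
  have "{m \<in> segment_lines L. segment_inc (Some (segment L p)) m}
      = {l \<in> lines_of L. inc p l} <+> {class_of p}"
    using segment_inc_segment_Inl segment_inc_segment_Inr class_of_in[OF p(1)] p(2)
    unfolding segment_lines_def by auto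
  then show ?thesis
    using card_lines_of_through[OF L p] finite_lines_of by (simp add: card_Plus)
qed

lemma segment_join_infinity:
  "\<exists>!m. m \<in> segment_lines L \<and> segment_inc None m \<and> segment_inc (Some (segment L p)) m"
  using class_of_in[OF p(1)] p(2)
  by (rule ex1_segment_lines_Inr)
    (auto simp: segment_inc_segment_Inr simp del: segment_inc.simps(4))

end

lemma segment_eq_iff:
  assumes "p \<in> points" "p' \<in> points" "class_inc (class_of p) L"
  shows "segment L p = segment L p' \<longleftrightarrow> same_segment L p p'"
proof
  assume "segment L p = segment L p'"
  then show "same_segment L p p'"
    using same_segment_refl[OF L assms(1,3)] assms(1) same_segment_sym
    unfolding segment_def by blast
next
  assume "same_segment L p p'"
  then have "same_segment L p x \<longleftrightarrow> same_segment L p' x" if "x \<in> points" for x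
    using same_segment_trans[OF _ _ L] same_segment_sym assms(1,2) that by blast
  then show "segment L p = segment L p'" unfolding segment_def by blast
qed

lemma segment_join:
  assumes p: "p \<in> points" "class_inc (class_of p) L"
    and p': "p' \<in> points" "class_inc (class_of p') L" and "segment L p \<noteq> segment L p'"
  shows "\<exists>!m. m \<in> segment_lines L \<and> segment_inc (Some (segment L p)) m
    \<and> segment_inc (Some (segment L p')) m"
proof (cases "class_of p = class_of p'")
  case True
  then have "\<not> (\<exists>l\<in>lines_of L. inc p l \<and> inc p' l)"
    using assms(5) segment_eq_iff[OF p(1) p'(1) p(2)] unfolding same_segment_def by blast
  then show ?thesis
    using class_of_in[OF p(1)] p(2) True
    by (intro ex1_segment_lines_Inr[where X = "class_of p"])
      (auto simp: segment_inc_segment_Inl p p' segment_inc_segment_Inr simp del: segment_inc.simps)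
next
  case False
  then have "\<exists>!l. l \<in> lines_of L \<and> inc p l \<and> inc p' l"
    by (rule line_join[OF L p(1) p'(1) p(2) p'(2)])
  then have "\<exists>!l. l \<in> lines_of L \<and> segment_inc (Some (segment L p)) (Inl l)
      \<and> segment_inc (Some (segment L p')) (Inl l)"
    using segment_inc_segment_Inl[OF p] segment_inc_segment_Inl[OF p']
    by (simp cong: conj_cong del: segment_inc.simps)
  then show ?thesis
    using False
    by (intro ex1_segment_lines_Inl)
      (auto simp: p p' segment_inc_segment_Inr simp del: segment_inc.simps)
qed

lemma segment_points_join:
  assumes "s \<in> segment_points L" "s' \<in> segment_points L" "s \<noteq> s'"
  shows "\<exists>!m. m \<in> segment_lines L \<and> segment_inc s m \<and> segment_inc s' m"
  using assms(1)
proof (cases rule: segment_points_cases)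
  case infinity
  obtain p where "p \<in> points" "class_inc (class_of p) L" "s' = Some (segment L p)"
    using segment_points_cases[OF assms(2)] assms(3) infinity by metis
  then show ?thesis unfolding infinity using segment_join_infinity by blast
next
  case s: (segment p)
  from assms(2) show ?thesis
  proof (cases rule: segment_points_cases)
    case infinity
    have "\<exists>!m. m \<in> segment_lines L \<and> segment_inc s' m \<and> segment_inc s m"
      unfolding infinity s(3) by (rule segment_join_infinity[OF s(1,2)])
    then show ?thesis by (simp only: conj_commute)
  next
    case s': (segment p')
    show ?thesis
      using segment_join[OF s(1,2) s'(1,2)] assms(3) unfolding s(3) s'(3) by simp
  qed
qed

lemma segment_meet_line:
  assumes l: "l \<in> lines_of L" and m: "m \<in> segment_lines L" "m \<noteq> Inl l"
  shows "\<exists>s\<in>segment_points L. segment_inc s (Inl l) \<and> segment_inc s m"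
  using m(1)
proof (cases rule: segment_lines_cases)
  case (line l')
  then obtain p where p: "p \<in> points" "inc p l" "inc p l'" using line_meet[OF L l] m(2) by blast
  then have "class_inc (class_of p) L" using class_inc_if_inc[OF L l] by blast
  then show ?thesis
    using line p l segment_inc_segment_Inl unfolding segment_points_def by auto
next
  case (point_class X)
  then obtain p where "p \<in> points" "class_of p = X" "inc p l"
    using line_meets_class[OF L l] by blast
  then show ?thesis
    using point_class l segment_inc_segment_Inl segment_inc_segment_Inr
    unfolding segment_points_def by auto
qed

theorem segment_plane:
  "finite_projective_plane (segment_points L) (segment_lines L) segment_inc q"
proof
  show "segment_points L \<noteq> {}" unfolding segment_points_def by simp
  show "\<exists>!m. m \<in> segment_lines L \<and> segment_inc s m \<and> segment_inc s' m"
    if "s \<in> segment_points L" "s' \<in> segment_points L" "s \<noteq> s'" for s s'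
    by (rule segment_points_join[OF that])
  show "\<exists>s\<in>segment_points L. segment_inc s m \<and> segment_inc s m'"
    if m: "m \<in> segment_lines L" "m' \<in> segment_lines L" "m \<noteq> m'" for m m'
  proof (cases m; cases m')
    fix X X' assume "m = Inr X" "m' = Inr X'"
    then show ?thesis unfolding segment_points_def by simp
  qed (use segment_meet_line m in \<open>force simp: segment_lines_def\<close>)+
  show "card {m \<in> segment_lines L. segment_inc s m} = q + 1" if "s \<in> segment_points L" for s
    using that
  proof (cases rule: segment_points_cases)
    case infinity
    then have "{m \<in> segment_lines L. segment_inc s m} = Inr ` {X \<in> point_classes. class_inc X L}"
      unfolding segment_lines_def by auto
    then show ?thesis using classes.card_points_on_line[OF L] by (simp add: card_image)
  qed (use card_segment_lines_through in simp)
  show "\<exists>s\<in>segment_points L. \<not> segment_inc s m" if "m \<in> segment_lines L" for m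
  proof (cases m)
    case (Inl l)
    then show ?thesis unfolding segment_points_def by simp
  next
    case (Inr X)
    have "\<not> {Y \<in> point_classes. class_inc Y L} \<subseteq> {X}"
    proof
      assume "{Y \<in> point_classes. class_inc Y L} \<subseteq> {X}"
      then have "card {Y \<in> point_classes. class_inc Y L} \<le> card {X}" by (intro card_mono) auto
      then show False using classes.card_points_on_line[OF L] classes.order_pos by simp
    qed
    then obtain p where p: "p \<in> points" "class_inc (class_of p) L" "class_of p \<noteq> X"
      using class_of_image by blast
    then have "\<not> segment_inc (Some (segment L p)) m" using segment_inc_segment_Inr Inr by blast
    then show ?thesis using p unfolding segment_points_def by auto
  qed
qed (fact finite_segment_points finite_segment_lines)+

lemma card_segment_transversal_le:
  assumes S: "S \<subseteq> points" "\<And>p. p \<in> S \<Longrightarrow> class_inc (class_of p) L"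
    and transversal: "\<And>p p'. \<lbrakk>p \<in> S; p' \<in> S; same_segment L p p'\<rbrakk> \<Longrightarrow> p = p'"
    and line_le: "\<And>l. l \<in> lines_of L \<Longrightarrow> card {p \<in> S. inc p l} \<le> 3"
    and class_le: "\<And>X. X \<in> point_classes \<Longrightarrow> card {p \<in> S. class_of p = X} \<le> 3"
    and order: "\<not> 3 dvd q" "q \<noteq> 2"
  shows "card S \<le> 2 * q + 1"
proof -
  interpret segments: finite_projective_plane "segment_points L" "segment_lines L" segment_inc q
    by (rule segment_plane)
  let ?T = "(\<lambda>p. Some (segment L p)) ` S"
  have inj: "inj_on (\<lambda>p. Some (segment L p)) S"
    using S segment_eq_iff transversal by (intro inj_onI) (auto simp: subset_iff)
  have "card {s \<in> ?T. segment_inc s m} \<le> 3" if "m \<in> segment_lines L" for m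
  proof -
    have "card {s \<in> ?T. segment_inc s m} = card {p \<in> S. segment_inc (Some (segment L p)) m}"
    proof -
      have "{s \<in> ?T. segment_inc s m}
          = (\<lambda>p. Some (segment L p)) ` {p \<in> S. segment_inc (Some (segment L p)) m}" by auto
      then show ?thesis using inj by (auto intro: card_image inj_on_subset)
    qed
    also have "\<dots> \<le> 3"
      using that
    proof (cases rule: segment_lines_cases)
      case (line l)
      then have "{p \<in> S. segment_inc (Some (segment L p)) m} = {p \<in> S. inc p l}"
        using S segment_inc_segment_Inl by blast
      then show ?thesis using line_le[OF line(1)] by simp
    next
      case (point_class X)
      then have "{p \<in> S. segment_inc (Some (segment L p)) m} = {p \<in> S. class_of p = X}"
        using S segment_inc_segment_Inr by blast
      then show ?thesis using class_le[OF point_class(1)] by simp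
    qed
    finally show ?thesis .
  qed
  moreover have "?T \<subseteq> segment_points L" using S unfolding segment_points_def by auto
  ultimately have "card ?T \<le> 2 * q + 1" using segments.card_arc_of_degree_3_le order by blast
  then show ?thesis using inj by (simp add: card_image)
qed

end

end

section \<open>Arcs in Hjelmslev planes\<close>

locale hjelmslev_arc =
  hjelmslev_plane point_classes line_classes class_inc q points class_of lines_of inc
  for point_classes :: "'x set" and line_classes :: "'y set"
    and class_inc :: "'x \<Rightarrow> 'y \<Rightarrow> bool" and q :: nat
    and points :: "'p set" and class_of :: "'p \<Rightarrow> 'x"
    and lines_of :: "'y \<Rightarrow> 'l set" and inc :: "'p \<Rightarrow> 'l \<Rightarrow> bool" +
  fixes K :: "'p set" and n :: nat
  assumes K_subset: "K \<subseteq> points"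
    and card_line_le: "\<lbrakk>L \<in> line_classes; l \<in> lines_of L\<rbrakk> \<Longrightarrow> card {p \<in> K. inc p l} \<le> n"
begin

lemma finite_K: "finite K"
  using K_subset finite_points finite_subset by blast

definition arc_class :: "'x \<Rightarrow> 'p set" where
  "arc_class X = {p \<in> K. class_of p = X}"

definition weight :: "'x \<Rightarrow> nat" where
  "weight X = card (arc_class X)"

definition line_weight :: "'y \<Rightarrow> nat" where
  "line_weight L = card {p \<in> K. class_inc (class_of p) L}"

definition segment_excess :: "'y \<Rightarrow> 'x \<Rightarrow> nat" where
  "segment_excess L X = excess (same_segment L) (arc_class X)"

definition class_excess :: "'x \<Rightarrow> nat" where
  "class_excess X = (\<Sum>L\<in>classes.pencil X. segment_excess L X)"

definition line_excess :: "'y \<Rightarrow> nat" where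
  "line_excess L = (\<Sum>X\<in>{X \<in> point_classes. class_inc X L}. segment_excess L X)"

lemma finite_arc_class: "finite (arc_class X)"
  unfolding arc_class_def using finite_K by simp

lemma arc_class_subset: "arc_class X \<subseteq> {p \<in> points. class_of p = X}"
  unfolding arc_class_def using K_subset by blast

lemma direction_system_arc_class:
  "direction_system (arc_class X) (classes.pencil X) same_segment"
  by (rule direction_system_in_class[OF arc_class_subset])

lemma total_excess_arc_class:
  "direction_system.total_excess (arc_class X) (classes.pencil X) same_segment
    = class_excess X"
  unfolding direction_system.total_excess_def[OF direction_system_arc_class] class_excess_def
    segment_excess_def ..

lemma segment_excess_attained:
  assumes "arc_class X \<noteq> {}"
  obtains p where "p \<in> arc_class X" "p \<in> points" "class_of p = X"
    "segment_excess L X = card (companions (same_segment L) (arc_class X) p)"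
  using excess_attained[OF finite_arc_class assms] arc_class_subset
  unfolding segment_excess_def by blast

subsection \<open>Heavy segments make light lines\<close>

lemma card_segment_and_rest_le:
  assumes "L \<in> line_classes" "l \<in> lines_of L" "p \<in> arc_class X" "inc p l"
  shows "card (companions (same_segment L) (arc_class X) p) + 1
    + card {x \<in> K. class_of x \<noteq> X \<and> inc x l} \<le> n"
proof -
  let ?seg = "insert p (companions (same_segment L) (arc_class X) p)"
    and ?rest = "{x \<in> K. class_of x \<noteq> X \<and> inc x l}"
  have p: "p \<in> K" "p \<in> points" "class_of p = X"
    using assms(3) K_subset unfolding arc_class_def by auto
  have finite_seg: "finite ?seg" using finite_companions[OF finite_arc_class] by simp
  have seg: "x \<in> K \<and> class_of x = X \<and> inc x l" if "x \<in> ?seg" for x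
    using that p assms(4) inc_same_segment[OF _ assms(1) p(2) _ assms(2,4), of x] K_subset
    unfolding companions_def arc_class_def by auto
  have "card (companions (same_segment L) (arc_class X) p) + 1 = card ?seg"
    using finite_seg by (simp add: companions_def)
  moreover have "card ?seg + card ?rest = card (?seg \<union> ?rest)"
    using finite_seg finite_K seg by (intro card_Un_disjoint[symmetric]) auto
  moreover have "card (?seg \<union> ?rest) \<le> card {x \<in> K. inc x l}"
    using finite_K seg by (intro card_mono) auto
  ultimately show ?thesis using card_line_le[OF assms(1,2)] by linarith
qed

text \<open>The \<^term>\<open>q\<close> lines of \<^term>\<open>L\<close> through a longest segment of \<^term>\<open>X\<close> cover the other
  point classes on \<^term>\<open>L\<close>.\<close>

lemma line_weight_excess_le:
  assumes "L \<in> line_classes" "class_inc X L" "arc_class X \<noteq> {}"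
  shows "line_weight L + q * (segment_excess L X + 1) \<le> weight X + n * q"
proof -
  obtain p where p: "p \<in> arc_class X" "p \<in> points" "class_of p = X"
    and excess_p: "segment_excess L X = card (companions (same_segment L) (arc_class X) p)"
    by (rule segment_excess_attained[OF assms(3)])
  let ?pencil = "{l \<in> lines_of L. inc p l}"
    and ?rest = "{x \<in> K. class_inc (class_of x) L \<and> class_of x \<noteq> X}"
  have card_pencil: "card ?pencil = q"
    using card_lines_of_through[OF assms(1) p(2)] p(3) assms(2) by simp
  have "card {x \<in> ?rest. inc x l} + (segment_excess L X + 1) \<le> n" if l: "l \<in> ?pencil" for l
  proof -
    have "card {x \<in> ?rest. inc x l} \<le> card {x \<in> K. class_of x \<noteq> X \<and> inc x l}"
      using finite_K by (intro card_mono) auto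
    then show ?thesis using card_segment_and_rest_le[OF assms(1) _ p(1), of l] l excess_p by simp
  qed
  then have "(\<Sum>l\<in>?pencil. card {x \<in> ?rest. inc x l} + (segment_excess L X + 1)) \<le> (\<Sum>l\<in>?pencil. n)"
    by (rule sum_mono)
  moreover have "(\<Sum>l\<in>?pencil. card {x \<in> ?rest. inc x l}) = card ?rest"
    using assms(1,2) p(2,3) K_subset by (intro sum_pencil_card_other_classes) auto
  ultimately have "card ?rest + q * (segment_excess L X + 1) \<le> n * q"
    unfolding sum.distrib using card_pencil by (simp add: mult.commute)
  moreover have "line_weight L = card (arc_class X \<union> ?rest)"
    unfolding line_weight_def arc_class_def
    using assms(2) by (intro arg_cong[where f = card]) auto
  then have "line_weight L = weight X + card ?rest"
    unfolding weight_def using finite_K finite_arc_class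
    by (simp add: card_Un_disjoint arc_class_def disjoint_iff)
  ultimately show ?thesis by simp
qed

lemma segment_excess_less:
  assumes "L \<in> line_classes" "class_inc X L" "arc_class X \<noteq> {}"
  shows "segment_excess L X < n"
proof -
  obtain p where p: "p \<in> arc_class X" "p \<in> points" "class_of p = X"
    and excess_p: "segment_excess L X = card (companions (same_segment L) (arc_class X) p)"
    by (rule segment_excess_attained[OF assms(3)])
  obtain l where "l \<in> lines_of L" "inc p l"
    using line_of_through[OF assms(1) p(2)] assms(2) p(3) by metis
  then show ?thesis using card_segment_and_rest_le[OF assms(1) _ p(1)] excess_p by fastforce
qed

lemma segment_excess_add_le:
  assumes "L \<in> line_classes" "X \<noteq> Y" "class_inc X L" "class_inc Y L"
    and "arc_class X \<noteq> {}" "arc_class Y \<noteq> {}"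
  shows "segment_excess L X + segment_excess L Y + 2 \<le> n"
proof -
  let ?companions = "\<lambda>X. companions (same_segment L) (arc_class X)"
  obtain p where p: "p \<in> arc_class X" "p \<in> points" "class_of p = X"
      "segment_excess L X = card (?companions X p)"
    by (rule segment_excess_attained[OF assms(5)])
  obtain r where r: "r \<in> arc_class Y" "r \<in> points" "class_of r = Y"
      "segment_excess L Y = card (?companions Y r)"
    by (rule segment_excess_attained[OF assms(6)])
  obtain l where l: "l \<in> lines_of L" "inc p l" "inc r l"
    using line_join[OF assms(1), of p r] assms(2-4) p(2,3) r(2,3) by blast
  have "insert r (?companions Y r) \<subseteq> {x \<in> K. class_of x \<noteq> X \<and> inc x l}"
    using r(1,3) assms(2) l K_subset inc_same_segment[OF _ assms(1) r(2) _ l(1,3)]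
    unfolding companions_def arc_class_def by auto
  then have "card (insert r (?companions Y r)) \<le> card {x \<in> K. class_of x \<noteq> X \<and> inc x l}"
    using finite_K by (intro card_mono) auto
  then show ?thesis
    using card_segment_and_rest_le[OF assms(1) l(1) p(1) l(2)] p(4) r(4)
      finite_companions[OF finite_arc_class] by (simp add: companions_def)
qed

subsection \<open>Counting incidences with the line classes\<close>

lemma card_pencil_inter:
  assumes "X \<in> point_classes" "Y \<in> point_classes"
  shows "card {L \<in> classes.pencil X. class_inc Y L} = 1 + q * of_bool (Y = X)"
proof (cases "Y = X")
  case True
  then have "{L \<in> classes.pencil X. class_inc Y L} = classes.pencil X" by auto
  then show ?thesis using classes.card_lines_through[OF assms(1)] True by simp
next
  case False
  then have "\<exists>!L. L \<in> line_classes \<and> class_inc X L \<and> class_inc Y L"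
    using classes.join[OF assms] by simp
  then show ?thesis using False by (auto simp: card_1_singleton_iff set_eq_iff)
qed

lemma sum_line_weight_pencil:
  assumes "X \<in> point_classes"
  shows "(\<Sum>L\<in>classes.pencil X. line_weight L) = card K + q * weight X"
proof -
  have "(\<Sum>L\<in>classes.pencil X. line_weight L) = (\<Sum>p\<in>K. 1 + q * of_bool (class_of p = X))"
    unfolding line_weight_def
  proof (rule sum_multicount_gen)
    show "\<forall>p\<in>K. card {L \<in> classes.pencil X. class_inc (class_of p) L}
        = 1 + q * of_bool (class_of p = X)"
      using K_subset class_of_in card_pencil_inter[OF assms] by blast
  qed (use finite_K classes.finite_lines in auto)
  also have "\<dots> = card K + q * weight X"
    unfolding weight_def arc_class_def sum.distrib sum_distrib_left[symmetric]
    using finite_K by (simp add: Int_def)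
  finally show ?thesis .
qed

lemma card_class_excess_le:
  assumes "X \<in> point_classes" "arc_class X \<noteq> {}"
  shows "card K + q * class_excess X + q * (q + 1) \<le> weight X + n * q * (q + 1)"
proof -
  have "(\<Sum>L\<in>classes.pencil X. line_weight L + q * (segment_excess L X + 1))
      \<le> (\<Sum>L\<in>classes.pencil X. weight X + n * q)"
    using line_weight_excess_le[OF _ _ assms(2)] by (intro sum_mono) auto
  also have "\<dots> = (q + 1) * (weight X + n * q)"
    using classes.card_lines_through[OF assms(1)] by simp
  finally have "card K + q * weight X + q * (class_excess X + (q + 1))
      \<le> (q + 1) * (weight X + n * q)"
    unfolding class_excess_def sum.distrib sum_distrib_left[symmetric]
      sum_line_weight_pencil[OF assms(1)] using classes.card_lines_through[OF assms(1)] by simp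
  then show ?thesis by (simp add: algebra_simps)
qed

lemma sum_over_classes: "(\<Sum>p\<in>K. f (class_of p)) = (\<Sum>X\<in>point_classes. weight X * (f X :: nat))"
proof -
  have "class_of ` K \<subseteq> point_classes" using K_subset class_of_in by blast
  then have "(\<Sum>p\<in>K. f (class_of p)) = (\<Sum>X\<in>point_classes. \<Sum>p\<in>arc_class X. f (class_of p))"
    unfolding arc_class_def by (rule sum.group[OF finite_K classes.finite_points, symmetric])
  also have "\<dots> = (\<Sum>X\<in>point_classes. weight X * f X)"
    by (intro sum.cong) (simp_all add: weight_def arc_class_def)
  finally show ?thesis .
qed

lemma sum_weight: "(\<Sum>X\<in>point_classes. weight X) = card K"
  using sum_over_classes[of "\<lambda>_. 1"] by simp

lemma sum_line_weight: "(\<Sum>L\<in>line_classes. line_weight L) = (q + 1) * card K"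
proof -
  have "(\<Sum>L\<in>line_classes. line_weight L) = (\<Sum>p\<in>K. q + 1)"
    unfolding line_weight_def using K_subset class_of_in classes.card_lines_through
    by (intro sum_multicount_gen classes.finite_lines finite_K) blast
  then show ?thesis by simp
qed

lemma sum_line_weight_sq:
  "(\<Sum>L\<in>line_classes. (line_weight L)^2) = (card K)^2 + q * (\<Sum>X\<in>point_classes. (weight X)^2)"
proof -
  have "(\<Sum>L\<in>line_classes. (line_weight L)^2)
      = (\<Sum>L\<in>line_classes. \<Sum>p\<in>{p \<in> K. class_inc (class_of p) L}. line_weight L)"
    by (simp add: line_weight_def power2_eq_square)
  also have "\<dots> = (\<Sum>p\<in>K. \<Sum>L\<in>classes.pencil (class_of p). line_weight L)"
    by (rule sum.swap_restrict[OF classes.finite_lines finite_K])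
  also have "\<dots> = (\<Sum>p\<in>K. card K + q * weight (class_of p))"
    using K_subset class_of_in sum_line_weight_pencil by (intro sum.cong) auto
  also have "\<dots> = (card K)^2 + q * (\<Sum>p\<in>K. weight (class_of p))"
    by (simp add: sum.distrib sum_distrib_left power2_eq_square)
  also have "(\<Sum>p\<in>K. weight (class_of p)) = (\<Sum>X\<in>point_classes. (weight X)^2)"
    unfolding power2_eq_square by (rule sum_over_classes)
  finally show ?thesis .
qed

lemma sum_line_excess: "(\<Sum>L\<in>line_classes. line_excess L) = (\<Sum>X\<in>point_classes. class_excess X)"
  unfolding line_excess_def class_excess_def
  by (rule sum.swap_restrict[OF classes.finite_lines classes.finite_points])

lemma weight_le_class_excess: "weight X \<le> class_excess X + 1"
  using direction_system.card_le_total_excess[OF direction_system_arc_class, of X]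
  unfolding total_excess_arc_class weight_def by linarith

lemma card_le_sum_line_excess: "card K \<le> (\<Sum>L\<in>line_classes. line_excess L) + (q^2 + q + 1)"
proof -
  have "card K \<le> (\<Sum>X\<in>point_classes. class_excess X + 1)"
    unfolding sum_weight[symmetric] by (rule sum_mono) (rule weight_le_class_excess)
  then show ?thesis unfolding sum_line_excess sum.distrib using classes.card_points by simp
qed

lemma first_moment_le:
  assumes "\<And>L. L \<in> line_classes \<Longrightarrow> line_weight L + r * line_excess L \<le> C"
  shows "(q + 1) * card K + r * (\<Sum>L\<in>line_classes. line_excess L) \<le> (q^2 + q + 1) * C"
proof -
  have "(\<Sum>L\<in>line_classes. line_weight L + r * line_excess L) \<le> (\<Sum>L\<in>line_classes. C)"
    by (rule sum_mono) (rule assms)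
  then show ?thesis
    using classes.card_lines sum_line_weight by (simp add: sum.distrib sum_distrib_left)
qed

end

subsection \<open>Arcs with at most three points on a line\<close>

text \<open>For order five the weight \<^term>\<open>w\<close> of a line class is compared with the parabola
  \<^term>\<open>(w - 9) * (w - 10)\<close>, which is nonnegative on the integers.\<close>

lemma parabola_ge:
  fixes w e :: int
  assumes "w + 5 * e \<le> 12" "0 \<le> e"
  shows "6 * e \<le> (w - 9) * (w - 10)"
proof (cases "e = 0")
  case True
  then show ?thesis
    by (cases "w \<le> 9") (auto intro: mult_nonneg_nonneg mult_nonpos_nonpos)
next
  case False
  then have "(5 * e - 3) * 3 \<le> (9 - w) * (10 - w)" using assms by (intro mult_mono) auto
  then show ?thesis using assms(2) False by (simp add: algebra_simps)
qed

locale hjelmslev_three_arc = hjelmslev_arc where n = 3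
begin

lemma line_weight_add_excess_le:
  assumes "L \<in> line_classes" "class_inc X L" "arc_class X \<noteq> {}"
  shows "line_weight L + q * segment_excess L X \<le> weight X + 2 * q"
  using line_weight_excess_le[OF assms] by simp

lemma arc_class_nonempty_if_excess: "segment_excess L X \<noteq> 0 \<Longrightarrow> arc_class X \<noteq> {}"
  unfolding segment_excess_def excess_def by auto

lemma segment_excess_le_2:
  assumes "L \<in> line_classes" "class_inc X L"
  shows "segment_excess L X \<le> 2"
proof (cases "segment_excess L X = 0")
  case False
  then show ?thesis
    using segment_excess_less[OF assms arc_class_nonempty_if_excess[OF False]] by simp
qed simp

lemma class_excess_ge_4:
  assumes "weight X = 4" fano_free
  shows "4 \<le> class_excess X"
proof (rule ccontr)
  assume "\<not> ?thesis"
  then have "\<exists>L\<in>classes.pencil X. \<exists>M\<in>classes.pencil X. \<exists>H\<in>classes.pencil X.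
      \<exists>a\<in>arc_class X. \<exists>b\<in>arc_class X. \<exists>c\<in>arc_class X. \<exists>d\<in>arc_class X.
      fano_quadrangle same_segment L M H a b c d"
    using assms(1) segment_excess_le_2[of _ X]
    by (intro direction_system.fano_quadrangle_if_total_excess_less[OF direction_system_arc_class])
      (auto simp: total_excess_arc_class weight_def segment_excess_def)
  then show False using assms(2) arc_class_subset unfolding fano_free_def by blast
qed

lemma class_excess_ge_5:
  assumes "weight X = 5"
  shows "5 \<le> class_excess X"
proof (cases "\<exists>L\<in>line_classes. class_inc X L \<and> segment_excess L X = 2")
  case True
  then obtain L where "L \<in> line_classes" "class_inc X L" "segment_excess L X = 2" by blast
  then have "2 * 2 < class_excess X"
    using direction_system.twice_excess_less_total_excess[OF direction_system_arc_class, of L X]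
      assms by (simp add: total_excess_arc_class weight_def segment_excess_def)
  then show ?thesis by simp
next
  case False
  then have "segment_excess L X \<le> 1" if "L \<in> line_classes" "class_inc X L" for L
    using segment_excess_le_2[OF that] that by (metis One_nat_def Suc_1 le_SucE)
  then show ?thesis
    using direction_system.card_le_total_excess_if_odd[OF direction_system_arc_class, of X] assms
    by (simp add: total_excess_arc_class weight_def segment_excess_def)
qed

lemma weight_class_excess_balance:
  assumes "weight X \<ge> 4" "odd q \<Longrightarrow> fano_free" "q \<ge> 2"
  shows "weight X + (if odd q then 4 else 3) * q \<le> 4 + q * class_excess X"
proof -
  have le_4q: "(if odd q then 4 else 3) * q \<le> 4 * q" by simp
  consider (four) "weight X = 4" | (five) "weight X = 5" | (larger) "weight X \<ge> 6"
    using assms(1) by linarith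
  then show ?thesis
  proof cases
    case four
    then have "(if odd q then 4 else 3) \<le> class_excess X"
      using class_excess_ge_4 assms(2) weight_le_class_excess[of X] by auto
    from mult_le_mono2[OF this, of q] show ?thesis using four by (simp add: mult.commute)
  next
    case five
    have "q * 5 \<le> q * class_excess X" using class_excess_ge_5[OF five] by (rule mult_le_mono2)
    then show ?thesis using five assms(3) le_4q by linarith
  next
    case larger
    then obtain j where j: "weight X = 6 + j" using le_Suc_ex by blast
    have "q * (5 + j) \<le> q * class_excess X"
      using weight_le_class_excess[of X] j by (intro mult_le_mono2) simp
    moreover have "1 * j \<le> q * j" using assms(3) by (intro mult_le_mono1) simp
    ultimately show ?thesis
      using j assms(3) le_4q unfolding distrib_left by linarith
  qed
qed

lemma card_le_if_heavy_class:
  assumes "X \<in> point_classes" "weight X \<ge> 4" "odd q \<Longrightarrow> fano_free" "q \<ge> 2"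
  shows "card K + (if odd q then 2 * q else q) \<le> 2 * q^2 + 4"
proof -
  have "arc_class X \<noteq> {}" using assms(2) unfolding weight_def by auto
  from card_class_excess_le[OF assms(1) this]
  have "card K + q * class_excess X \<le> weight X + 2 * q * (q + 1)" by (simp add: algebra_simps)
  then show ?thesis
    using weight_class_excess_balance[OF assms(2,3,4)]
    by (auto simp: power2_eq_square algebra_simps split: if_splits)
qed

lemma line_excess_cases:
  assumes "L \<in> line_classes"
  obtains (none) "line_excess L = 0"
      "\<And>X. \<lbrakk>X \<in> point_classes; class_inc X L\<rbrakk> \<Longrightarrow> segment_excess L X = 0"
    | (single) X where "X \<in> point_classes" "class_inc X L" "arc_class X \<noteq> {}"
      "line_excess L = segment_excess L X" "line_excess L \<ge> 1"
proof (cases "\<exists>X\<in>point_classes. class_inc X L \<and> segment_excess L X \<noteq> 0")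
  case True
  then obtain X where X: "X \<in> point_classes" "class_inc X L" "segment_excess L X \<noteq> 0" by blast
  note X_nonempty = arc_class_nonempty_if_excess[OF X(3)]
  have "segment_excess L Y = 0" if "class_inc Y L" "Y \<noteq> X" for Y
    using segment_excess_add_le[OF assms that(2,1) X(2) _ X_nonempty]
      arc_class_nonempty_if_excess[of L Y] X(3) by fastforce
  then have "line_excess L = (\<Sum>Y\<in>{X}. segment_excess L Y)"
    unfolding line_excess_def using X classes.finite_points
    by (intro sum.mono_neutral_right) auto
  then show ?thesis using single[OF X(1,2) X_nonempty] X(3) by simp
next
  case False
  then show ?thesis using none unfolding line_excess_def by simp
qed

lemma line_weight_line_excess_le:
  assumes "L \<in> line_classes" "\<And>X. X \<in> point_classes \<Longrightarrow> weight X \<le> c"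
  shows "line_weight L + q * line_excess L \<le> 2 * q + c"
  using assms(1)
proof (cases rule: line_excess_cases)
  case none
  show ?thesis
  proof (cases "\<exists>p\<in>K. class_inc (class_of p) L")
    case True
    then obtain p where p: "p \<in> K" "class_inc (class_of p) L" by blast
    then have "arc_class (class_of p) \<noteq> {}" "weight (class_of p) \<le> c"
      using assms(2) K_subset class_of_in unfolding arc_class_def by auto
    then show ?thesis
      using line_weight_add_excess_le[OF assms(1) p(2)] none(1) by (simp add: add.commute)
  next
    case False
    then have "{p \<in> K. class_inc (class_of p) L} = {}" by blast
    then show ?thesis unfolding line_weight_def none(1) by (simp only: card.empty)
  qed
next
  case (single X)
  then show ?thesis
    using line_weight_add_excess_le[OF assms(1) single(2,3)] assms(2)[OF single(1)] by simp
qed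

lemma line_weight_le_if_no_excess:
  assumes L: "L \<in> line_classes"
    and no_excess: "\<And>X. \<lbrakk>X \<in> point_classes; class_inc X L\<rbrakk> \<Longrightarrow> segment_excess L X = 0"
    and light: "\<And>X. X \<in> point_classes \<Longrightarrow> weight X \<le> 3" and order: "\<not> 3 dvd q" "q \<noteq> 2"
  shows "line_weight L \<le> 2 * q + 1"
proof -
  let ?S = "{p \<in> K. class_inc (class_of p) L}"
  have "card ?S \<le> 2 * q + 1"
  proof (rule card_segment_transversal_le[OF L])
    fix p p' assume p: "p \<in> ?S" "p' \<in> ?S" and same: "same_segment L p p'"
    let ?X = "class_of p"
    have in_class: "p \<in> arc_class ?X" "p' \<in> arc_class ?X"
      using p same unfolding arc_class_def same_segment_def by auto
    have "card (companions (same_segment L) (arc_class ?X) p) \<le> segment_excess L ?X"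
      unfolding segment_excess_def
      by (rule card_companions_le_excess[OF finite_arc_class in_class(1)])
    then have "companions (same_segment L) (arc_class ?X) p = {}"
      using no_excess[of ?X] p K_subset class_of_in finite_companions[OF finite_arc_class] by auto
    then show "p = p'" using in_class(2) same unfolding companions_def by blast
  next
    fix l assume "l \<in> lines_of L"
    then have "card {p \<in> K. inc p l} \<le> 3" by (rule card_line_le[OF L])
    moreover have "card {p \<in> ?S. inc p l} \<le> card {p \<in> K. inc p l}"
      using finite_K by (intro card_mono) auto
    ultimately show "card {p \<in> ?S. inc p l} \<le> 3" by linarith
  next
    fix X assume "X \<in> point_classes"
    then have "card (arc_class X) \<le> 3" using light unfolding weight_def by blast
    moreover have "card {p \<in> ?S. class_of p = X} \<le> card (arc_class X)"
      unfolding arc_class_def using finite_K by (intro card_mono) auto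
    ultimately show "card {p \<in> ?S. class_of p = X} \<le> 3" by linarith
  qed (use K_subset order in auto)
  then show ?thesis unfolding line_weight_def .
qed

lemma line_weight_le:
  assumes "L \<in> line_classes" "\<And>X. X \<in> point_classes \<Longrightarrow> weight X \<le> 3" "\<not> 3 dvd q" "q \<ge> 3"
  shows "line_weight L \<le> 2 * q + 1"
  using assms(1)
proof (cases rule: line_excess_cases)
  case none
  then show ?thesis using line_weight_le_if_no_excess[OF assms(1) _ assms(2,3)] assms(4) by simp
next
  case (single X)
  have "q * 1 \<le> q * line_excess L" using single(5) by (rule mult_le_mono2)
  moreover have "line_weight L + q * line_excess L \<le> 2 * q + 3"
    using assms(2) by (rule line_weight_line_excess_le[OF assms(1)])
  ultimately show ?thesis using assms(4) by linarith
qed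

text \<open>The bounds below are stated without subtraction: the bound on \<^term>\<open>card K\<close> in the odd case
  is \<^term>\<open>2 * q^2 - 2 * q + 4\<close>.\<close>

lemma card_le_if_three_dvd:
  assumes "\<And>X. X \<in> point_classes \<Longrightarrow> weight X \<le> 3" "3 dvd q" "q \<ge> 5"
  shows "card K + (if odd q then 2 * q else q) \<le> 2 * q^2 + 4"
proof -
  let ?N = "q^2 + q + 1" and ?E = "\<Sum>L\<in>line_classes. line_excess L"
  have "(q + 1) * card K + q * ?E \<le> ?N * (2 * q + 3)"
    using line_weight_line_excess_le assms(1) by (intro first_moment_le) blast
  moreover have "q * card K \<le> q * (?E + ?N)"
    using card_le_sum_line_excess by (rule mult_le_mono2)
  ultimately have moment: "(2 * q + 1) * card K \<le> 3 * ?N * (q + 1)"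
    by (simp add: algebra_simps)
  \<comment> \<open>The order is not assumed to be a prime power, so \<^term>\<open>q = 6\<close> is not excluded.\<close>
  consider (six) "q = 6" | (larger) "q \<ge> 9" using assms(2,3) by (elim dvdE) force
  then show ?thesis
  proof cases
    case six
    then show ?thesis using moment by simp
  next
    case larger
    have "card K + 2 * q \<le> 2 * q^2 + 4"
    proof (rule ccontr)
      assume "\<not> ?thesis"
      then have "(2 * q + 1) * (2 * q^2 + 5) \<le> (2 * q + 1) * (card K + 2 * q)"
        by (intro mult_le_mono2) simp
      then have "4 * (q * (q * q)) + 8 * q + 5 \<le> 2 * (q * card K) + card K + 2 * (q * q)"
        by (simp add: algebra_simps power2_eq_square)
      moreover have "2 * (q * card K) + card K \<le> 3 * (q * (q * q)) + 6 * (q * q) + 6 * q + 3"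
        using moment by (simp add: algebra_simps power2_eq_square)
      moreover have "9 * (q * q) \<le> q * (q * q)" using larger by (rule mult_le_mono1)
      ultimately show False by linarith
    qed
    then show ?thesis by simp
  qed
qed

lemma card_le_if_full_segment:
  assumes "\<And>X. X \<in> point_classes \<Longrightarrow> weight X \<le> 3" "\<not> 3 dvd q" "q \<ge> 3"
    and "X \<in> point_classes" "weight X = 3"
    and L: "L \<in> line_classes" "class_inc X L" "segment_excess L X = 2"
  shows "card K + 2 * q \<le> 2 * q^2 + 4"
proof -
  have pencil: "finite (classes.pencil X)" "L \<in> classes.pencil X"
    using classes.finite_lines L by auto
  have "arc_class X \<noteq> {}" using assms(5) unfolding weight_def by auto
  then have "line_weight L \<le> 3" using line_weight_add_excess_le[OF L(1,2)] L(3) assms(5) by simp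
  moreover have "(\<Sum>M\<in>classes.pencil X - {L}. line_weight M)
      \<le> (\<Sum>M\<in>classes.pencil X - {L}. 2 * q + 1)"
    using line_weight_le[OF _ assms(1-3)] by (intro sum_mono) auto
  moreover have "card (classes.pencil X - {L}) = q"
    using classes.card_lines_through[OF assms(4)] pencil by simp
  moreover have "card K + 3 * q = line_weight L + (\<Sum>M\<in>classes.pencil X - {L}. line_weight M)"
    using sum_line_weight_pencil[OF assms(4)] assms(5) sum.remove[OF pencil, of line_weight] by simp
  ultimately have "card K + 3 * q \<le> 3 + q * (2 * q + 1)" by simp
  then show ?thesis by (simp add: power2_eq_square algebra_simps)
qed

lemma card_le_if_no_full_segment:
  assumes "\<And>X. X \<in> point_classes \<Longrightarrow> weight X \<le> 3" "\<not> 3 dvd q" "q \<ge> 3"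
    and "X \<in> point_classes" "weight X = 3"
    and excess_le_1: "\<And>L. \<lbrakk>L \<in> line_classes; class_inc X L\<rbrakk> \<Longrightarrow> segment_excess L X \<le> 1"
  shows "card K + 2 * q \<le> 2 * q^2 + 4"
proof -
  have nonempty: "arc_class X \<noteq> {}" using assms(5) unfolding weight_def by auto
  have "3 \<le> class_excess X"
    using direction_system.card_le_total_excess_if_odd[OF direction_system_arc_class, of X]
      assms(5) excess_le_1 by (simp add: total_excess_arc_class weight_def segment_excess_def)
  then have "(q - 2) * 3 \<le> (q - 2) * class_excess X" by (rule mult_le_mono2)
  moreover have "line_weight L + (q - 2) * segment_excess L X \<le> 2 * q + 1"
    if L: "L \<in> classes.pencil X" for L
  proof (cases "segment_excess L X = 0")
    case True
    then show ?thesis using line_weight_le[OF _ assms(1-3), of L] L by simp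
  next
    case False
    then have "segment_excess L X = 1" using excess_le_1[of L] L by simp
    then show ?thesis
      using line_weight_add_excess_le[OF _ _ nonempty, of L] L assms(3,5) by simp
  qed
  then have "(\<Sum>L\<in>classes.pencil X. line_weight L + (q - 2) * segment_excess L X)
      \<le> (\<Sum>L\<in>classes.pencil X. 2 * q + 1)"
    by (rule sum_mono)
  then have "card K + q * 3 + (q - 2) * class_excess X \<le> (q + 1) * (2 * q + 1)"
    unfolding sum.distrib sum_line_weight_pencil[OF assms(4)] assms(5) sum_distrib_left[symmetric]
      class_excess_def using classes.card_lines_through[OF assms(4)] by simp
  ultimately show ?thesis using assms(3) by (simp add: power2_eq_square algebra_simps)
qed

lemma card_le_if_class_of_three:
  assumes "\<And>X. X \<in> point_classes \<Longrightarrow> weight X \<le> 3" "\<not> 3 dvd q" "q \<ge> 3"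
    and "X \<in> point_classes" "weight X = 3"
  shows "card K + 2 * q \<le> 2 * q^2 + 4"
proof (cases "\<exists>L\<in>line_classes. class_inc X L \<and> segment_excess L X = 2")
  case True
  then show ?thesis using card_le_if_full_segment[OF assms] by blast
next
  case False
  then have "segment_excess L X \<le> 1" if "L \<in> line_classes" "class_inc X L" for L
    using segment_excess_le_2[OF that] that by force
  then show ?thesis using card_le_if_no_full_segment[OF assms] by blast
qed

context
  assumes weight_le_2: "\<And>X. X \<in> point_classes \<Longrightarrow> weight X \<le> 2"
    and order: "\<not> 3 dvd q" "q \<ge> 5"
begin

lemma first_moment_le_if_weight_le_2:
  "(q + 1) * card K + (q - 1) * (\<Sum>L\<in>line_classes. line_excess L) \<le> (q^2 + q + 1) * (2 * q + 1)"
proof (rule first_moment_le)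
  fix L assume L: "L \<in> line_classes"
  then show "line_weight L + (q - 1) * line_excess L \<le> 2 * q + 1"
  proof (cases rule: line_excess_cases)
    case none
    have "weight X \<le> 3" if "X \<in> point_classes" for X using weight_le_2[OF that] by simp
    then show ?thesis using line_weight_le[OF L] order none(1) by simp
  next
    case (single X)
    have "q * line_excess L = (q - 1) * line_excess L + line_excess L"
      using order(2) by (simp add: algebra_simps)
    then show ?thesis
      using line_weight_line_excess_le[OF L weight_le_2] single(5) by fastforce
  qed
qed

lemma twice_card_le: "2 * card K \<le> 3 * (q^2 + q + 1)"
proof -
  define N where "N = q^2 + q + 1"
  let ?E = "\<Sum>L\<in>line_classes. line_excess L"
  obtain r where r: "q = Suc r" using classes.order_pos gr0_implies_Suc by blast
  have "r * card K \<le> r * (?E + N)"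
    unfolding N_def using card_le_sum_line_excess by (rule mult_le_mono2)
  moreover have "(r + 2) * card K + r * ?E \<le> N * (2 * r + 3)"
    using first_moment_le_if_weight_le_2 unfolding N_def[symmetric] by (simp add: r algebra_simps)
  ultimately have "(r + 1) * (2 * card K) \<le> (r + 1) * (3 * N)"
    by (simp add: algebra_simps)
  then have "2 * card K \<le> 3 * N" by (simp only: mult_le_cancel1)
  then show ?thesis unfolding N_def .
qed

lemma sum_weight_sq_le:
  "(\<Sum>X\<in>point_classes. (weight X)^2) \<le> card K + 2 * (\<Sum>L\<in>line_classes. line_excess L)"
proof -
  have "(weight X)^2 \<le> weight X + 2 * class_excess X" if "X \<in> point_classes" for X
  proof -
    have "weight X \<in> {0, 1, 2}" using weight_le_2[OF that] by auto
    then show ?thesis using weight_le_class_excess[of X] by auto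
  qed
  then have "(\<Sum>X\<in>point_classes. (weight X)^2)
      \<le> (\<Sum>X\<in>point_classes. weight X + 2 * class_excess X)"
    by (rule sum_mono)
  then show ?thesis
    by (simp only: sum.distrib sum_distrib_left[symmetric] sum_weight sum_line_excess)
qed

lemma card_le_44_if_order_5:
  assumes "q = 5"
  shows "card K \<le> 44"
proof -
  let ?E = "\<Sum>L\<in>line_classes. line_excess L"
  have "19 * line_weight L + 6 * line_excess L \<le> (line_weight L)^2 + 90"
    if "L \<in> line_classes" for L
  proof -
    have "line_weight L + 5 * line_excess L \<le> 12"
      using line_weight_line_excess_le[OF that weight_le_2] assms by simp
    then have "6 * int (line_excess L) \<le> (int (line_weight L) - 9) * (int (line_weight L) - 10)"
      by (intro parabola_ge) simp_all
    then have "int (19 * line_weight L + 6 * line_excess L) \<le> int ((line_weight L)^2 + 90)"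
      by (simp add: algebra_simps power2_eq_square)
    then show ?thesis by (simp only: of_nat_le_iff)
  qed
  then have "(\<Sum>L\<in>line_classes. 19 * line_weight L + 6 * line_excess L)
      \<le> (\<Sum>L\<in>line_classes. (line_weight L)^2 + 90)"
    by (rule sum_mono)
  then have "19 * (6 * card K) + 6 * ?E
      \<le> (card K)^2 + 5 * (\<Sum>X\<in>point_classes. (weight X)^2) + 31 * 90"
    unfolding sum.distrib sum_distrib_left[symmetric] sum_line_weight sum_line_weight_sq
    using classes.card_lines assms by simp
  moreover have "(\<Sum>X\<in>point_classes. (weight X)^2) \<le> card K + 2 * ?E" by (rule sum_weight_sq_le)
  moreover have "6 * card K + 4 * ?E \<le> 341" "card K \<le> ?E + 31"
    using first_moment_le_if_weight_le_2 card_le_sum_line_excess assms by simp_all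
  ultimately have quadratic: "115 * card K \<le> (card K)^2 + 3131" and "card K \<le> 46" by linarith+
  moreover have "card K \<noteq> 45" "card K \<noteq> 46" using quadratic by auto
  ultimately show ?thesis by linarith
qed

lemma card_le_if_weight_le_2: "card K + 2 * q \<le> 2 * q^2 + 4"
proof (cases "q = 5")
  case True
  then show ?thesis using card_le_44_if_order_5 by simp
next
  case False
  then obtain j where "q = 6 + j" using order(2) le_Suc_ex[of 6 q] by auto
  then show ?thesis using twice_card_le by (simp add: power2_eq_square algebra_simps)
qed

end

theorem card_arc_le:
  assumes "q \<ge> 5" "odd q \<Longrightarrow> fano_free"
  shows "card K + (if odd q then 2 * q else q) \<le> 2 * q^2 + 4"
proof (cases "\<exists>X\<in>point_classes. weight X \<ge> 4")
  case True
  then show ?thesis using card_le_if_heavy_class assms by force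
next
  case False
  then have weight_le_3: "weight X \<le> 3" if "X \<in> point_classes" for X using that by force
  show ?thesis
  proof (cases "3 dvd q")
    case True
    then show ?thesis using card_le_if_three_dvd weight_le_3 assms(1) by blast
  next
    case not_dvd: False
    have "card K + 2 * q \<le> 2 * q^2 + 4"
    proof (cases "\<exists>X\<in>point_classes. weight X = 3")
      case True
      then show ?thesis using card_le_if_class_of_three weight_le_3 not_dvd assms(1) by force
    next
      case False
      then have "weight X \<le> 2" if "X \<in> point_classes" for X
        using weight_le_3[OF that] that by force
      then show ?thesis using card_le_if_weight_le_2 not_dvd assms(1) by blast
    qed
    then show ?thesis by simp
  qed
qed

end

section \<open>Row and column vectors of length three\<close>

definition dot :: "'r::ring_1 vec3 \<Rightarrow> 'r vec3 \<Rightarrow> 'r" where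
  "dot m v = fst m * fst v + fst (snd m) * fst (snd v) + snd (snd m) * snd (snd v)"

definition lsmul :: "'r::ring_1 \<Rightarrow> 'r vec3 \<Rightarrow> 'r vec3" where
  "lsmul r m = (r * fst m, r * fst (snd m), r * snd (snd m))"

lemma vadd_eq_plus: "vadd x y = x + y"
  by (simp add: vadd_def prod_eq_iff)

lemma dot_add_left: "dot (m + m') v = dot m v + dot m' v"
  and dot_add_right: "dot m (v + w) = dot m v + dot m w"
  and dot_diff_left: "dot (m - m') v = dot m v - dot m' v"
  and dot_diff_right: "dot m (v - w) = dot m v - dot m w"
  and dot_vsmul: "dot m (vsmul v r) = dot m v * r"
  and dot_lsmul: "dot (lsmul r m) v = r * dot m v"
  and dot_zero_right: "dot m 0 = 0"
  by (simp_all add: dot_def lsmul_def vsmul_def algebra_simps)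

lemmas dot_simps = dot_add_left dot_add_right dot_diff_left dot_diff_right dot_vsmul dot_lsmul
  dot_zero_right

lemma vsmul_assoc: "vsmul (vsmul v r) s = vsmul v (r * s)"
  and vsmul_one: "vsmul v 1 = v"
  and vsmul_add: "vsmul v (r + s) = vsmul v r + vsmul v s"
  and vsmul_diff: "vsmul v (r - s) = vsmul v r - vsmul v s"
  and vsmul_add_left: "vsmul (v + w) r = vsmul v r + vsmul w r"
  and vsmul_diff_left: "vsmul (v - w) r = vsmul v r - vsmul w r"
  and vsmul_zero: "vsmul v 0 = 0"
  and lsmul_assoc: "lsmul r (lsmul s m) = lsmul (r * s) m"
  and lsmul_one: "lsmul 1 m = m"
  and lsmul_add: "lsmul (r + s) m = lsmul r m + lsmul s m"
  and lsmul_diff: "lsmul (r - s) m = lsmul r m - lsmul s m"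
  and lsmul_add_right: "lsmul r (m + m') = lsmul r m + lsmul r m'"
  and lsmul_diff_right: "lsmul r (m - m') = lsmul r m - lsmul r m'"
  and lsmul_zero: "lsmul 0 m = 0"
  by (simp_all add: vsmul_def lsmul_def prod_eq_iff algebra_simps)

lemmas smul_simps = vsmul_assoc vsmul_one vsmul_add vsmul_diff vsmul_add_left vsmul_diff_left
  vsmul_zero lsmul_assoc lsmul_one lsmul_add lsmul_diff lsmul_add_right lsmul_diff_right lsmul_zero

lemma dot_eqI:
  assumes "\<And>v. dot m v = dot m' v"
  shows "m = m'"
  using assms[of "(1, 0, 0)"] assms[of "(0, 1, 0)"] assms[of "(0, 0, 1)"]
  by (simp add: dot_def prod_eq_iff)

definition dual_bases ::
  "'r::ring_1 vec3 \<Rightarrow> 'r vec3 \<Rightarrow> 'r vec3 \<Rightarrow> 'r vec3 \<Rightarrow> 'r vec3 \<Rightarrow> 'r vec3 \<Rightarrow> bool" where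
  "dual_bases x y z a b c \<longleftrightarrow>
     dot a x = 1 \<and> dot a y = 0 \<and> dot a z = 0 \<and>
     dot b x = 0 \<and> dot b y = 1 \<and> dot b z = 0 \<and>
     dot c x = 0 \<and> dot c y = 0 \<and> dot c z = 1 \<and>
     (\<forall>v. v = vsmul x (dot a v) + vsmul y (dot b v) + vsmul z (dot c v))"

lemma dual_bases_dots:
  assumes "dual_bases x y z a b c"
  shows "dot a x = 1" "dot a y = 0" "dot a z = 0" "dot b x = 0" "dot b y = 1" "dot b z = 0"
    "dot c x = 0" "dot c y = 0" "dot c z = 1"
  using assms unfolding dual_bases_def by auto

lemma dual_bases_column_expansion:
  assumes "dual_bases x y z a b c"
  shows "v = vsmul x (dot a v) + vsmul y (dot b v) + vsmul z (dot c v)"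
  using assms unfolding dual_bases_def by blast

lemma dual_bases_row_expansion:
  assumes "dual_bases x y z a b c"
  shows "m = lsmul (dot m x) a + lsmul (dot m y) b + lsmul (dot m z) c"
proof (rule dot_eqI)
  fix v
  have "dot m v = dot m (vsmul x (dot a v) + vsmul y (dot b v) + vsmul z (dot c v))"
    using dual_bases_column_expansion[OF assms, of v] by simp
  then show "dot m v = dot (lsmul (dot m x) a + lsmul (dot m y) b + lsmul (dot m z) c) v"
    by (simp add: dot_simps)
qed

lemma dual_bases_swap: "dual_bases x y z a b c \<Longrightarrow> dual_bases x z y a c b"
  unfolding dual_bases_def by (simp add: ac_simps)

section \<open>Chain rings of length two\<close>

lemma even_card_if_additive_involution:
  fixes c :: "'r::{ring_1,finite}"
  assumes "c \<noteq> 0" "c + c = 0"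
  shows "even (card (UNIV :: 'r set))"
proof -
  have "even (\<Sum>x\<in>UNIV. card (companions (\<lambda>x y. y = x + c) UNIV x))"
    using assms(2) by (intro even_sum_card_companions) (simp_all add: add.assoc)
  moreover have "companions (\<lambda>x y. y = x + c) UNIV x = {x + c}" for x
    using assms(1) unfolding companions_def by auto
  ultimately show ?thesis by simp
qed

locale chain_ring =
  fixes N :: "'r::{ring_1,finite} set"
  assumes chain: "chain_ring2 N"
begin

subsection \<open>The radical\<close>

lemma left_ideal_iff: "left_ideal A \<longleftrightarrow> A = UNIV \<or> A = N \<or> A = {0}"
  and right_ideal_iff: "right_ideal A \<longleftrightarrow> A = UNIV \<or> A = N \<or> A = {0}"
proof -
  have "{I. left_ideal I} = {UNIV, N, {0}}" "{I. right_ideal I} = {UNIV, N, {0}}"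
    using chain unfolding chain_ring2_def by simp_all
  then show "left_ideal A \<longleftrightarrow> A = UNIV \<or> A = N \<or> A = {0}"
    "right_ideal A \<longleftrightarrow> A = UNIV \<or> A = N \<or> A = {0}"
    by (metis (no_types) insert_iff mem_Collect_eq singletonD)+
qed

lemma left_ideal_N: "left_ideal N" and right_ideal_N: "right_ideal N"
  unfolding left_ideal_iff right_ideal_iff by simp_all

lemma zero_in_N: "0 \<in> N" and N_add: "\<lbrakk>a \<in> N; b \<in> N\<rbrakk> \<Longrightarrow> a + b \<in> N"
  and N_uminus: "a \<in> N \<Longrightarrow> - a \<in> N" and N_mult_left: "a \<in> N \<Longrightarrow> r * a \<in> N"
  and N_mult_right: "a \<in> N \<Longrightarrow> a * r \<in> N"
  using left_ideal_N right_ideal_N unfolding left_ideal_def right_ideal_def by auto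

lemma N_diff: "\<lbrakk>a \<in> N; b \<in> N\<rbrakk> \<Longrightarrow> a - b \<in> N"
  using N_add[of a "- b"] N_uminus by simp

lemmas N_closed = zero_in_N N_add N_uminus N_mult_left N_mult_right N_diff

lemma N_cong: "a - b \<in> N \<Longrightarrow> a \<in> N \<longleftrightarrow> b \<in> N"
  using N_add[of "a - b" b] N_diff[of a "a - b"] by auto

lemma N_mult_N: "\<lbrakk>a \<in> N; b \<in> N\<rbrakk> \<Longrightarrow> a * b = 0"
  using chain unfolding chain_ring2_def by blast

lemma right_ideal_principal: "right_ideal (range ((*) (r :: 'r)))"
  unfolding right_ideal_def
  by (auto simp: image_iff) (metis mult_zero_right distrib_left mult_minus_right mult.assoc)+

lemma left_ideal_principal: "left_ideal (range (\<lambda>s. s * (r :: 'r)))"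
  unfolding left_ideal_def
  by (auto simp: image_iff) (metis mult_zero_left distrib_right mult_minus_left mult.assoc)+

lemma principal_right_cases:
  obtains "range ((*) r) = UNIV" | "r \<in> N" "range ((*) r) = N" | "r = 0"
proof -
  have "r \<in> range ((*) r)" by (metis mult.right_neutral rangeI)
  then show ?thesis
    using right_ideal_principal[of r] that unfolding right_ideal_iff by auto
qed

lemma principal_left_cases:
  obtains "range (\<lambda>s. s * r) = UNIV" | "r \<in> N" "range (\<lambda>s. s * r) = N" | "r = 0"
proof -
  have "r \<in> range (\<lambda>s. s * r)" by (metis mult.left_neutral rangeI)
  then show ?thesis
    using left_ideal_principal[of r] that unfolding left_ideal_iff by auto
qed

lemma unit_if_notin_N:
  assumes "r \<notin> N"
  shows "\<exists>s. r * s = 1 \<and> s * r = 1"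
proof -
  have "r \<noteq> 0" using assms zero_in_N by blast
  have "range ((*) r) = UNIV"
    by (rule principal_right_cases[of r]) (use assms \<open>r \<noteq> 0\<close> in auto)
  moreover have "range (\<lambda>s. s * r) = UNIV"
    by (rule principal_left_cases[of r]) (use assms \<open>r \<noteq> 0\<close> in auto)
  ultimately obtain s t where "r * s = 1" "t * r = 1" by (metis UNIV_I imageE)
  moreover from this have "t = s" by (metis mult.assoc mult_1_left mult_1_right)
  ultimately show ?thesis by blast
qed

definition unit_inv :: "'r \<Rightarrow> 'r" where
  "unit_inv r = (SOME s. r * s = 1 \<and> s * r = 1)"

lemma unit_inv_right: "r \<notin> N \<Longrightarrow> r * unit_inv r = 1"
  and unit_inv_left: "r \<notin> N \<Longrightarrow> unit_inv r * r = 1"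
  using someI_ex[OF unit_if_notin_N] unfolding unit_inv_def by blast+

lemma unit_inv_right_assoc: "r \<notin> N \<Longrightarrow> r * (unit_inv r * s) = s"
  and unit_inv_left_assoc: "r \<notin> N \<Longrightarrow> unit_inv r * (r * s) = s"
  using unit_inv_right unit_inv_left by (simp_all add: mult.assoc[symmetric])

lemma one_notin_N: "1 \<notin> N"
proof
  assume "1 \<in> N"
  then have "N = UNIV" using N_mult_left[of 1] by auto
  then show False using chain unfolding chain_ring2_def by simp
qed

lemma unit_inv_notin_N: "r \<notin> N \<Longrightarrow> unit_inv r \<notin> N"
  using unit_inv_right[of r] N_mult_left[of "unit_inv r" r] one_notin_N by auto

lemma unit_mult_in_N_iff: "r \<notin> N \<Longrightarrow> r * a \<in> N \<longleftrightarrow> a \<in> N"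
  using unit_inv_left_assoc[of r a] N_mult_left[of "r * a" "unit_inv r"] N_mult_left[of a r]
  by auto

lemma N_generated_right: "\<lbrakk>a \<in> N; a \<noteq> 0; b \<in> N\<rbrakk> \<Longrightarrow> \<exists>r. b = a * r"
  by (rule principal_right_cases[of a]) auto

lemma N_generated_left: "\<lbrakk>a \<in> N; a \<noteq> 0; b \<in> N\<rbrakk> \<Longrightarrow> \<exists>r. b = r * a"
  by (rule principal_left_cases[of a]) auto

lemma in_N_if_mult_eq_0_left: "\<lbrakk>r * a = 0; a \<noteq> 0\<rbrakk> \<Longrightarrow> r \<in> N"
  by (rule ccontr) (metis mult_zero_right unit_inv_left_assoc)

lemma in_N_if_mult_eq_0_right: "\<lbrakk>a * r = 0; a \<noteq> 0\<rbrakk> \<Longrightarrow> r \<in> N"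
  by (rule ccontr) (metis mult.assoc mult_1_right mult_zero_left unit_inv_right)

lemma N_nonzero: "\<exists>a\<in>N. a \<noteq> 0"
proof -
  have "N \<noteq> {0}" using chain unfolding chain_ring2_def by blast
  then show ?thesis using zero_in_N by blast
qed

subsection \<open>Cardinality\<close>

lemma card_coset: "card {r. r - s \<in> N} = card N"
proof -
  have "{r. r - s \<in> N} = (\<lambda>n. n + s) ` N" by (auto simp: image_iff) (metis diff_add_cancel)
  then show ?thesis by (simp add: card_image inj_on_def)
qed

lemma card_N_pos: "card N > 0"
  using zero_in_N by (auto simp: card_gt_0_iff)

text \<open>Multiplication with a nonzero element of \<^term>\<open>N\<close> maps the ring onto \<^term>\<open>N\<close>, with
  kernel \<^term>\<open>N\<close>.\<close>

lemma card_UNIV_eq: "card (UNIV :: 'r set) = card N * card N"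
proof -
  obtain a where a: "a \<in> N" "a \<noteq> 0" using N_nonzero by blast
  have "(\<Sum>n\<in>N. card {r \<in> UNIV. a * r = n}) = card (UNIV :: 'r set)"
    by (rule sum_card_eq_card_if_ex1) (use N_mult_right[OF a(1)] in auto)
  moreover have "card {r \<in> UNIV. a * r = n} = card N" if n: "n \<in> N" for n
  proof -
    obtain s where s: "n = a * s" using N_generated_right[OF a n] by blast
    have "a * r = n \<longleftrightarrow> r - s \<in> N" for r
      using in_N_if_mult_eq_0_right[of a "r - s"] a N_mult_N[OF a(1), of "r - s"] unfolding s
      by (auto simp: right_diff_distrib)
    then show ?thesis using card_coset[of s] by simp
  qed
  ultimately show ?thesis by simp
qed

lemma transversal:
  obtains T where "card T = card N" "\<forall>r. \<exists>!t. t \<in> T \<and> r - t \<in> N"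
proof -
  define rep where "rep r = (SOME s. r - s \<in> N)" for r
  have rep: "r - rep r \<in> N" for r
    unfolding rep_def by (rule someI[of _ r]) (simp add: zero_in_N)
  have rep_eq: "rep r = rep s" if "r - s \<in> N" for r s
    unfolding rep_def using N_cong[of "r - u" "s - u" for u] that by simp
  have unique: "\<exists>!t. t \<in> range rep \<and> r - t \<in> N" for r
  proof (rule ex1I[of _ "rep r"])
    fix t assume t: "t \<in> range rep \<and> r - t \<in> N"
    then obtain s where s: "t = rep s" by blast
    have "(r - t) - (s - t) \<in> N" using N_diff t rep[of s] unfolding s by blast
    then show "t = rep r" using rep_eq[of r s] s by simp
  qed (use rep in auto)
  have "(\<Sum>t\<in>range rep. card {r \<in> UNIV. r - t \<in> N}) = card (UNIV :: 'r set)"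
    by (rule sum_card_eq_card_if_ex1) (use unique in auto)
  then have "card (range rep) * card N = card N * card N" using card_coset card_UNIV_eq by simp
  then have "card (range rep) = card N" using card_N_pos by (simp only: mult_right_cancel)
  then show ?thesis using that unique by blast
qed

lemma two_notin_N:
  assumes "odd (card N)"
  shows "1 + 1 \<notin> N"
proof
  assume two: "1 + 1 \<in> N"
  have odd_card: "odd (card (UNIV :: 'r set))" using assms card_UNIV_eq by simp
  have "(1::'r) \<noteq> 0" using one_notin_N zero_in_N by metis
  then have "(1::'r) + 1 \<noteq> 0" using even_card_if_additive_involution[of 1] odd_card by blast
  moreover have "(1 + 1) + (1 + 1) = (1 + 1) * (1 + 1 :: 'r)" by (simp add: algebra_simps)
  then have "(1 + 1) + (1 + 1) = (0 :: 'r)" using N_mult_N[OF two two] by simp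
  ultimately show False using even_card_if_additive_involution odd_card by blast
qed

subsection \<open>Vectors modulo the radical\<close>

definition in_rad :: "'r vec3 \<Rightarrow> bool" where
  "in_rad v \<longleftrightarrow> fst v \<in> N \<and> fst (snd v) \<in> N \<and> snd (snd v) \<in> N"

lemma in_rad_add: "\<lbrakk>in_rad v; in_rad w\<rbrakk> \<Longrightarrow> in_rad (v + w)"
  and in_rad_diff: "\<lbrakk>in_rad v; in_rad w\<rbrakk> \<Longrightarrow> in_rad (v - w)"
  and in_rad_zero: "in_rad 0"
  and in_rad_vsmul: "in_rad v \<Longrightarrow> in_rad (vsmul v r)"
  and in_rad_vsmul_N: "r \<in> N \<Longrightarrow> in_rad (vsmul v r)"
  and in_rad_lsmul_N: "r \<in> N \<Longrightarrow> in_rad (lsmul r v)"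
  by (auto simp: in_rad_def vsmul_def lsmul_def N_closed)

lemma dot_in_N_left: "in_rad m \<Longrightarrow> dot m v \<in> N"
  and dot_in_N_right: "in_rad v \<Longrightarrow> dot m v \<in> N"
  by (auto simp: in_rad_def dot_def N_closed)

lemma not_in_rad_left: "dot m v = 1 \<Longrightarrow> \<not> in_rad m"
  and not_in_rad_right: "dot m v = 1 \<Longrightarrow> \<not> in_rad v"
  using dot_in_N_left[of m v] dot_in_N_right[of v m] one_notin_N by auto

lemma dot_rad_rad: "\<lbrakk>in_rad m; in_rad v\<rbrakk> \<Longrightarrow> dot m v = 0"
  by (auto simp: in_rad_def dot_def N_mult_N)

lemma in_rad_if_diff: "\<lbrakk>in_rad (v - w); in_rad w\<rbrakk> \<Longrightarrow> in_rad v"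
  using in_rad_add[of "v - w" w] by simp

lemma dual_bases_ex:
  assumes "\<not> in_rad x"
  obtains y z a b c where "dual_bases x y z a b c"
proof -
  obtain x1 x2 x3 where x: "x = (x1, x2, x3)" by (metis prod.exhaust)
  consider (first) "x1 \<notin> N" | (second) "x2 \<notin> N" | (third) "x3 \<notin> N"
    using assms unfolding x in_rad_def by auto
  then show ?thesis
  proof cases
    case first
    let ?i = "unit_inv x1"
    have "dual_bases x (0,1,0) (0,0,1) (?i, 0, 0) (- x2 * ?i, 1, 0) (- x3 * ?i, 0, 1)"
      unfolding dual_bases_def x
      by (simp add: dot_def vsmul_def mult.assoc unit_inv_left[OF first]
          unit_inv_right_assoc[OF first])
    then show ?thesis by (rule that)
  next
    case second
    let ?i = "unit_inv x2"
    have "dual_bases x (1,0,0) (0,0,1) (0, ?i, 0) (1, - x1 * ?i, 0) (0, - x3 * ?i, 1)"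
      unfolding dual_bases_def x
      by (simp add: dot_def vsmul_def mult.assoc unit_inv_left[OF second]
          unit_inv_right_assoc[OF second])
    then show ?thesis by (rule that)
  next
    case third
    let ?i = "unit_inv x3"
    have "dual_bases x (1,0,0) (0,1,0) (0, 0, ?i) (1, 0, - x1 * ?i) (0, 1, - x2 * ?i)"
      unfolding dual_bases_def x
      by (simp add: dot_def vsmul_def mult.assoc unit_inv_left[OF third]
          unit_inv_right_assoc[OF third])
    then show ?thesis by (rule that)
  qed
qed

lemma dual_bases_exchange_column:
  assumes bases: "dual_bases x u z a b c" and y: "dot b y \<notin> N"
  shows "\<exists>a b c. dual_bases x y z a b c"
proof -
  let ?i = "unit_inv (dot b y)"
  let ?a = "a - lsmul (dot a y * ?i) b" and ?b = "lsmul ?i b"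
    and ?c = "c - lsmul (dot c y * ?i) b"
  have expansion: "v = vsmul x (dot ?a v) + vsmul y (dot ?b v) + vsmul z (dot ?c v)" for v
  proof -
    let ?s = "?i * dot b v"
    have "vsmul y ?s = vsmul x (dot a y * ?s) + vsmul u (dot b v) + vsmul z (dot c y * ?s)"
      using arg_cong[OF dual_bases_column_expansion[OF bases, of y], of "\<lambda>t. vsmul t ?s"]
        unit_inv_right_assoc[OF y] by (simp add: smul_simps)
    then have "vsmul x (dot ?a v) + vsmul y (dot ?b v) + vsmul z (dot ?c v)
        = vsmul x (dot a v) + vsmul u (dot b v) + vsmul z (dot c v)"
      by (simp add: dot_simps smul_simps mult.assoc)
    then show ?thesis using dual_bases_column_expansion[OF bases, of v] by simp
  qed
  have "dual_bases x y z ?a ?b ?c"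
    unfolding dual_bases_def using expansion
    by (auto simp: dot_simps dual_bases_dots[OF bases] unit_inv_left[OF y] mult.assoc)
  then show ?thesis by blast
qed

lemma dual_bases_exchange_row:
  assumes bases: "dual_bases x u z a b c" and m: "dot m z \<notin> N"
  shows "\<exists>y z. dual_bases x y z a b (m - lsmul (dot m x) a)"
proof -
  let ?i = "unit_inv (dot m z)"
  let ?y = "u - vsmul z (?i * dot m u)" and ?z = "vsmul z ?i" and ?c = "m - lsmul (dot m x) a"
  have dot_c: "dot ?c v = dot m u * dot b v + dot m z * dot c v" for v
    using arg_cong[OF dual_bases_row_expansion[OF bases, of m], of "\<lambda>t. dot t v"]
    by (simp add: dot_simps)
  have "vsmul x (dot a v) + vsmul ?y (dot b v) + vsmul ?z (dot ?c v)
      = vsmul x (dot a v) + vsmul u (dot b v) + vsmul z (dot c v)" for v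
    unfolding dot_c using unit_inv_left_assoc[OF m]
    by (simp add: dot_simps smul_simps mult.assoc distrib_left)
  then have "v = vsmul x (dot a v) + vsmul ?y (dot b v) + vsmul ?z (dot ?c v)" for v
    using trans[OF dual_bases_column_expansion[OF bases] sym] by blast
  then have "dual_bases x ?y ?z a b ?c"
    unfolding dual_bases_def
    by (auto simp: dot_simps dual_bases_dots[OF bases] unit_inv_right[OF m]
        unit_inv_right_assoc[OF m])
  then show ?thesis by blast
qed

lemma dual_bases_ex_row:
  assumes "\<not> in_rad x" "\<not> in_rad m" "dot m x \<in> N"
  obtains y z a b where "dual_bases x y z a b (m - lsmul (dot m x) a)"
proof -
  obtain y z a b c where bases: "dual_bases x y z a b c" using dual_bases_ex[OF assms(1)] .
  have "dot m y \<notin> N \<or> dot m z \<notin> N"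
  proof (rule ccontr)
    assume "\<not> ?thesis"
    then have "in_rad (lsmul (dot m x) a + lsmul (dot m y) b + lsmul (dot m z) c)"
      using assms(3) by (intro in_rad_add in_rad_lsmul_N) auto
    then show False using dual_bases_row_expansion[OF bases, of m] assms(2) by simp
  qed
  then show ?thesis
    using dual_bases_exchange_row[OF bases] dual_bases_exchange_row[OF dual_bases_swap[OF bases]]
      that by blast
qed

lemma row_kernel_ex:
  assumes "\<not> in_rad m"
  shows "\<exists>x. \<not> in_rad x \<and> dot m x = 0"
proof -
  obtain m1 m2 m3 where m: "m = (m1, m2, m3)" by (metis prod.exhaust)
  consider (first) "m1 \<notin> N" | (second) "m2 \<notin> N" | (third) "m3 \<notin> N"
    using assms unfolding m in_rad_def by auto
  then show ?thesis
  proof cases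
    case first
    then show ?thesis
      using one_notin_N by (intro exI[of _ "(- unit_inv m1 * m2, 1, 0)"])
        (simp add: m dot_def in_rad_def unit_inv_right_assoc)
  next
    case second
    then show ?thesis
      using one_notin_N by (intro exI[of _ "(1, - unit_inv m2 * m1, 0)"])
        (simp add: m dot_def in_rad_def unit_inv_right_assoc)
  next
    case third
    then show ?thesis
      using one_notin_N by (intro exI[of _ "(1, 0, - unit_inv m3 * m1)"])
        (simp add: m dot_def in_rad_def unit_inv_right_assoc)
  qed
qed

lemma dual_bases_ex_for_row:
  assumes "\<not> in_rad m"
  obtains x y z a b where "dual_bases x y z a b m"
proof -
  obtain x where x: "\<not> in_rad x" "dot m x = 0" using row_kernel_ex[OF assms] by blast
  obtain y z a b where "dual_bases x y z a b (m - lsmul (dot m x) a)"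
    using dual_bases_ex_row[OF x(1) assms] x(2) zero_in_N by metis
  then show ?thesis using that x(2) by (simp add: smul_simps)
qed

end

section \<open>The projective Hjelmslev plane over a chain ring\<close>

context chain_ring
begin

definition point :: "'r vec3 \<Rightarrow> 'r vec3 set" where
  "point x = range (vsmul x)"

definition line :: "'r vec3 \<Rightarrow> 'r vec3 set" where
  "line m = {v. dot m v = 0}"

definition point_class :: "'r vec3 \<Rightarrow> 'r vec3 set" where
  "point_class x = {v. \<exists>r. in_rad (v - vsmul x r)}"

definition line_class :: "'r vec3 \<Rightarrow> 'r vec3 set" where
  "line_class m = {v. dot m v \<in> N}"

subsection \<open>Points and point classes\<close>

lemma point_subset_line_iff: "point x \<subseteq> line m \<longleftrightarrow> dot m x = 0"
proof
  assume "point x \<subseteq> line m"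
  moreover have "vsmul x 1 \<in> point x" unfolding point_def by blast
  ultimately show "dot m x = 0" unfolding line_def vsmul_one by blast
qed (auto simp: point_def line_def dot_simps)

lemma point_vsmul:
  assumes "r \<notin> N"
  shows "point (vsmul x r) = point x"
proof -
  have "vsmul x s = vsmul (vsmul x r) (unit_inv r * s)" for s
    using unit_inv_right_assoc[OF assms] by (simp add: smul_simps)
  then have "point x \<subseteq> point (vsmul x r)" unfolding point_def by blast
  moreover have "point (vsmul x r) \<subseteq> point x" unfolding point_def vsmul_assoc by blast
  ultimately show ?thesis by blast
qed

lemma hpoints_eq: "hpoints = {point x | x. \<not> in_rad x}"
proof -
  have "(\<forall>r. vsmul x r = (0, 0, 0) \<longrightarrow> r = 0) \<longleftrightarrow> \<not> in_rad x" for x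
  proof
    assume free: "\<forall>r. vsmul x r = (0, 0, 0) \<longrightarrow> r = 0"
    obtain n where n: "n \<in> N" "n \<noteq> 0" using N_nonzero by blast
    have "vsmul x n = (0, 0, 0)" if "in_rad x"
      using that n(1) N_mult_N by (simp add: in_rad_def vsmul_def)
    then show "\<not> in_rad x" using free n(2) by blast
  next
    assume "\<not> in_rad x"
    then obtain y z a b c where bases: "dual_bases x y z a b c" using dual_bases_ex by blast
    have "dot a (vsmul x r) = r" for r by (simp add: dot_simps dual_bases_dots[OF bases])
    then show "\<forall>r. vsmul x r = (0, 0, 0) \<longrightarrow> r = 0"
      by (metis dot_def fst_conv snd_conv mult_zero_right add_0)
  qed
  moreover have "{vsmul x r | r. True} = point x" for x unfolding point_def by auto
  ultimately show ?thesis unfolding hpoints_def by auto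
qed

lemma self_in_point_class: "x \<in> point_class x"
  unfolding point_class_def using vsmul_one[of x] in_rad_zero by (auto intro!: exI[of _ 1])

lemma point_class_subset:
  assumes "v \<in> point_class w"
  shows "point_class v \<subseteq> point_class w"
proof
  fix u assume "u \<in> point_class v"
  then obtain s where s: "in_rad (u - vsmul v s)" unfolding point_class_def by auto
  obtain r where r: "in_rad (v - vsmul w r)" using assms unfolding point_class_def by auto
  have "in_rad ((u - vsmul v s) + vsmul (v - vsmul w r) s)"
    using s r by (intro in_rad_add in_rad_vsmul)
  then show "u \<in> point_class w" unfolding point_class_def by (auto simp: smul_simps)
qed

lemma unit_scalar_of_neighbour:
  assumes "\<not> in_rad v" "v \<in> point_class w"
  obtains r where "r \<notin> N" "in_rad (v - vsmul w r)"
  using assms in_rad_if_diff[of v "vsmul w r" for r] in_rad_vsmul_N unfolding point_class_def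
  by blast

lemma point_class_eqI:
  assumes "\<not> in_rad v" "v \<in> point_class w"
  shows "point_class v = point_class w"
proof
  obtain r where r: "r \<notin> N" "in_rad (v - vsmul w r)" by (rule unit_scalar_of_neighbour[OF assms])
  have "vsmul (v - vsmul w r) (- unit_inv r) = w - vsmul v (unit_inv r)"
    using unit_inv_right[OF r(1)] vsmul_diff[of "v - vsmul w r" 0 "unit_inv r"]
    by (simp add: smul_simps)
  then have "w \<in> point_class v"
    using in_rad_vsmul[OF r(2)] unfolding point_class_def by (metis (mono_tags) mem_Collect_eq)
  then show "point_class w \<subseteq> point_class v" by (rule point_class_subset)
qed (rule point_class_subset[OF assms(2)])

lemma point_class_subset_line_class_iff: "point_class x \<subseteq> line_class m \<longleftrightarrow> dot m x \<in> N"
proof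
  assume "point_class x \<subseteq> line_class m"
  then show "dot m x \<in> N" using self_in_point_class unfolding line_class_def by blast
next
  assume x: "dot m x \<in> N"
  show "point_class x \<subseteq> line_class m"
  proof
    fix v assume "v \<in> point_class x"
    then obtain r where "in_rad (v - vsmul x r)" unfolding point_class_def by auto
    then have "dot m v - dot m x * r \<in> N" using dot_in_N_right by (simp flip: dot_simps)
    then show "v \<in> line_class m" unfolding line_class_def using N_cong N_mult_right[OF x] by blast
  qed
qed

subsection \<open>Lines and line classes\<close>

lemma line_class_eqI:
  assumes "in_rad (m - lsmul r m')" "r \<notin> N"
  shows "line_class m = line_class m'"
proof -
  have "dot m v \<in> N \<longleftrightarrow> dot m' v \<in> N" for v
  proof -
    have "dot m v - r * dot m' v \<in> N"
      using dot_in_N_left[OF assms(1), of v] by (simp add: dot_simps)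
    then show ?thesis using N_cong unit_mult_in_N_iff[OF assms(2)] by blast
  qed
  then show ?thesis unfolding line_class_def by simp
qed

lemma line_lsmul: "r \<notin> N \<Longrightarrow> line (lsmul r m) = line m"
  unfolding line_def dot_lsmul using unit_inv_left_assoc[of r]
  by (auto dest: arg_cong[of _ _ "(*) (unit_inv r)"])

lemma line_in_hlines:
  assumes "\<not> in_rad m"
  shows "line m \<in> hlines"
proof -
  obtain x y z a b where bases: "dual_bases x y z a b m" using dual_bases_ex_for_row[OF assms] .
  note dots = dual_bases_dots[OF bases]
  have "line m = {vadd (vsmul x r) (vsmul y s) | r s. True}"
  proof
    show "line m \<subseteq> {vadd (vsmul x r) (vsmul y s) | r s. True}"
    proof
      fix v assume "v \<in> line m"
      then have "v = vadd (vsmul x (dot a v)) (vsmul y (dot b v))"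
        using dual_bases_column_expansion[OF bases, of v]
        unfolding line_def by (simp add: vadd_eq_plus smul_simps)
      then show "v \<in> {vadd (vsmul x r) (vsmul y s) | r s. True}" by blast
    qed
  qed (auto simp: line_def vadd_eq_plus dot_simps dots)
  moreover have "r = 0 \<and> s = 0" if zero: "vadd (vsmul x r) (vsmul y s) = (0, 0, 0)" for r s
  proof -
    have "dot t (vadd (vsmul x r) (vsmul y s)) = 0" for t unfolding zero by (simp add: dot_def)
    from this[of a] this[of b] show ?thesis by (simp add: vadd_eq_plus dot_simps dots)
  qed
  ultimately show ?thesis unfolding hlines_def by blast
qed

context
  fixes x y z a b c :: "'r vec3"
  assumes bases: "dual_bases x y z a b c"
begin

lemmas dots = dual_bases_dots[OF bases]

lemma line_class_eq_third:
  assumes "\<not> in_rad m" "dot m x \<in> N" "dot m y \<in> N"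
  shows "line_class m = line_class c" "dot m z \<notin> N"
proof -
  have "m - lsmul (dot m z) c = lsmul (dot m x) a + lsmul (dot m y) b"
    using dual_bases_row_expansion[OF bases, of m] by (simp add: algebra_simps)
  then have rad: "in_rad (m - lsmul (dot m z) c)"
    using assms(2,3) by (simp add: in_rad_add in_rad_lsmul_N)
  show z: "dot m z \<notin> N" using in_rad_if_diff[OF rad in_rad_lsmul_N] assms(1) by blast
  show "line_class m = line_class c" by (rule line_class_eqI[OF rad z])
qed

lemma line_eq_third:
  assumes "\<not> in_rad m" "dot m x = 0" "dot m y = 0"
  shows "line m = line c"
proof -
  have "m = lsmul (dot m z) c"
    using dual_bases_row_expansion[OF bases, of m] assms by (simp add: smul_simps)
  moreover have "dot m z \<notin> N" using line_class_eq_third(2)[OF assms(1)] assms zero_in_N by simp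
  ultimately show ?thesis using line_lsmul by metis
qed

lemma pencil_not_in_rad: "\<not> in_rad (c + lsmul t b)"
  by (rule not_in_rad_left[of _ z]) (simp add: dot_simps dots)

lemma line_class_pencil_eqD:
  assumes "line_class (c + lsmul t b) = line_class (c + lsmul t' b)"
  shows "t - t' \<in> N"
proof -
  have "y - vsmul z t' \<in> line_class (c + lsmul t' b)"
    unfolding line_class_def using zero_in_N by (simp add: dot_simps dots)
  then have "y - vsmul z t' \<in> line_class (c + lsmul t b)" using assms by simp
  then show ?thesis unfolding line_class_def by (simp add: dot_simps dots)
qed

lemma line_class_pencil_neq: "line_class b \<noteq> line_class (c + lsmul t b)"
proof -
  have "z \<in> line_class b" unfolding line_class_def using zero_in_N dots by simp
  moreover have "z \<notin> line_class (c + lsmul t b)"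
    unfolding line_class_def using one_notin_N by (simp add: dot_simps dots)
  ultimately show ?thesis by blast
qed

lemma line_class_in_pencil:
  assumes "dot m x \<in> N" "dot m z \<notin> N" "unit_inv (dot m z) * dot m y - t \<in> N"
  shows "line_class m = line_class (c + lsmul t b)"
proof (rule line_class_eqI[OF _ assms(2)])
  have "dot m z * (unit_inv (dot m z) * dot m y - t) \<in> N" using assms(3) by (rule N_mult_left)
  then have "dot m y - dot m z * t \<in> N"
    by (simp add: right_diff_distrib unit_inv_right_assoc[OF assms(2)])
  then have "in_rad (lsmul (dot m x) a + lsmul (dot m y - dot m z * t) b)"
    using assms(1) by (intro in_rad_add in_rad_lsmul_N)
  also have "lsmul (dot m x) a + lsmul (dot m y - dot m z * t) b
      = m - lsmul (dot m z) (c + lsmul t b)"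
    using dual_bases_row_expansion[OF bases, of m] by (simp add: smul_simps algebra_simps)
  finally show "in_rad (m - lsmul (dot m z) (c + lsmul t b))" .
qed

lemma line_pencil_eqD:
  assumes "line (c + lsmul t b) = line (c + lsmul t' b)"
  shows "t = t'"
proof -
  have "y - vsmul z t' \<in> line (c + lsmul t' b)" unfolding line_def by (simp add: dot_simps dots)
  then have "y - vsmul z t' \<in> line (c + lsmul t b)" using assms by simp
  then show ?thesis unfolding line_def by (simp add: dot_simps dots)
qed

lemma line_in_pencil:
  assumes "dot m x = 0" "dot m z \<notin> N"
  shows "line m = line (c + lsmul (unit_inv (dot m z) * dot m y) b)"
proof -
  have "m = lsmul (dot m z) (c + lsmul (unit_inv (dot m z) * dot m y) b)"
    using dual_bases_row_expansion[OF bases, of m] assms(1)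
    by (simp add: smul_simps unit_inv_right_assoc[OF assms(2)] add.commute)
  then show ?thesis using line_lsmul[OF assms(2)] by metis
qed

end

lemma dual_bases_ex_column:
  assumes "\<not> in_rad x" "y \<notin> point_class x"
  obtains z a b c where "dual_bases x y z a b c"
proof -
  obtain u z a b c where bases: "dual_bases x u z a b c" using dual_bases_ex[OF assms(1)] .
  have "dot b y \<notin> N \<or> dot c y \<notin> N"
  proof (rule ccontr)
    assume "\<not> ?thesis"
    then have "in_rad (vsmul u (dot b y) + vsmul z (dot c y))"
      by (intro in_rad_add in_rad_vsmul_N) auto
    also have "vsmul u (dot b y) + vsmul z (dot c y) = y - vsmul x (dot a y)"
      using dual_bases_column_expansion[OF bases, of y] by (simp add: algebra_simps)
    finally show False using assms(2) unfolding point_class_def by blast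
  qed
  then show ?thesis
    using dual_bases_exchange_column[OF bases]
      dual_bases_exchange_column[OF dual_bases_swap[OF bases]]
      that by blast
qed

lemma line_class_eq_imp_congruent:
  assumes "\<not> in_rad m" "\<not> in_rad m'" "line_class m = line_class m'"
  obtains r where "in_rad (m' - lsmul r m)"
proof -
  obtain x y z a b where bases: "dual_bases x y z a b m"
    using dual_bases_ex_for_row[OF assms(1)] .
  have "x \<in> line_class m" "y \<in> line_class m"
    unfolding line_class_def using dual_bases_dots[OF bases] zero_in_N by auto
  then have "dot m' x \<in> N" "dot m' y \<in> N" using assms(3) unfolding line_class_def by auto
  then have "in_rad (lsmul (dot m' x) a + lsmul (dot m' y) b)"
    by (intro in_rad_add in_rad_lsmul_N)
  also have "lsmul (dot m' x) a + lsmul (dot m' y) b = m' - lsmul (dot m' z) m"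
    using dual_bases_row_expansion[OF bases, of m'] by (simp add: algebra_simps)
  finally show ?thesis by (rule that)
qed

lemma dot_rad_eq_0_cong:
  assumes "\<not> in_rad m" "\<not> in_rad m'" "line_class m = line_class m'" "in_rad n" "dot m n = 0"
  shows "dot m' n = 0"
proof -
  obtain r where r: "in_rad (m' - lsmul r m)" by (rule line_class_eq_imp_congruent[OF assms(1-3)])
  have "dot (m' - lsmul r m) n = 0" by (rule dot_rad_rad[OF r assms(4)])
  then show ?thesis using assms(5) by (simp add: dot_simps)
qed

subsection \<open>The incidence axioms\<close>

definition class_of :: "'r vec3 set \<Rightarrow> 'r vec3 set" where
  "class_of P = {v. \<exists>u\<in>P. in_rad (v - u)}"

definition point_classes :: "'r vec3 set set" where
  "point_classes = {point_class x | x. \<not> in_rad x}"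

definition line_classes :: "'r vec3 set set" where
  "line_classes = {line_class m | m. \<not> in_rad m}"

definition lines_of :: "'r vec3 set \<Rightarrow> 'r vec3 set set" where
  "lines_of L = {line m | m. \<not> in_rad m \<and> line_class m = L}"

lemma point_in_hpoints: "\<not> in_rad x \<Longrightarrow> point x \<in> hpoints"
  and point_class_in: "\<not> in_rad x \<Longrightarrow> point_class x \<in> point_classes"
  and line_class_in: "\<not> in_rad m \<Longrightarrow> line_class m \<in> line_classes"
  and line_in_lines_of: "\<not> in_rad m \<Longrightarrow> line m \<in> lines_of (line_class m)"
  unfolding hpoints_eq point_classes_def line_classes_def lines_of_def by blast+

lemma hpointsE:
  assumes "P \<in> hpoints"
  obtains x where "\<not> in_rad x" "P = point x"
  using assms unfolding hpoints_eq by blast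

lemma point_classesE:
  assumes "X \<in> point_classes"
  obtains x where "\<not> in_rad x" "X = point_class x"
  using assms unfolding point_classes_def by blast

lemma line_classesE:
  assumes "L \<in> line_classes"
  obtains m where "\<not> in_rad m" "L = line_class m"
  using assms unfolding line_classes_def by blast

lemma lines_ofE:
  assumes "l \<in> lines_of L"
  obtains m where "\<not> in_rad m" "l = line m" "line_class m = L"
  using assms unfolding lines_of_def by blast

lemma line_classes_throughE:
  assumes "L \<in> line_classes" "point_class x \<subseteq> L"
  obtains m where "\<not> in_rad m" "L = line_class m" "dot m x \<in> N"
  using assms by (metis line_classesE point_class_subset_line_class_iff)

lemma lines_of_throughE:
  assumes "l \<in> lines_of L" "point x \<subseteq> l"
  obtains m where "\<not> in_rad m" "l = line m" "line_class m = L" "dot m x = 0"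
  using assms by (metis lines_ofE point_subset_line_iff)

lemma class_of_point: "class_of (point x) = point_class x"
  unfolding class_of_def point_def point_class_def by auto

lemma class_of_image: "class_of ` hpoints = point_classes"
  using class_of_point point_in_hpoints point_class_in
  by (auto elim!: hpointsE point_classesE simp del: split_paired_All intro!: image_eqI)

lemma neighbour_translate:
  assumes "\<not> in_rad x" "in_rad n"
  shows "\<not> in_rad (x + n)" "class_of (point (x + n)) = point_class x"
proof -
  show rad: "\<not> in_rad (x + n)" using in_rad_diff[of "x + n" n] assms by auto
  have "in_rad (x + n - vsmul x 1)" using assms(2) by (simp add: smul_simps)
  then have "x + n \<in> point_class x" unfolding point_class_def by blast
  then show "class_of (point (x + n)) = point_class x"
    unfolding class_of_point by (rule point_class_eqI[OF rad])
qed

lemma card_line_classes_through: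
  assumes "X \<in> point_classes"
  shows "card {L \<in> line_classes. X \<subseteq> L} = card N + 1"
proof -
  obtain x where x: "\<not> in_rad x" "X = point_class x" using point_classesE[OF assms] .
  obtain y z a b c where bases: "dual_bases x y z a b c" using dual_bases_ex[OF x(1)] .
  note dots = dual_bases_dots[OF bases]
  obtain T where card_T: "card T = card N" and T: "\<forall>r. \<exists>!t. t \<in> T \<and> r - t \<in> N"
    by (rule transversal)
  let ?pencil = "\<lambda>t. line_class (c + lsmul t b)"
  have "L = line_class b \<or> L \<in> ?pencil ` T" if L: "L \<in> {L \<in> line_classes. X \<subseteq> L}" for L
  proof -
    obtain m where m: "\<not> in_rad m" "L = line_class m" "dot m x \<in> N"
      using line_classes_throughE[of L x] L x(2) by blast
    obtain t where "t \<in> T" "unit_inv (dot m z) * dot m y - t \<in> N" using T by blast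
    then show ?thesis
      using line_class_eq_third(1)[OF dual_bases_swap[OF bases] m(1,3)]
        line_class_in_pencil[OF bases m(3)] m(2) by blast
  qed
  moreover have "line_class b \<in> {L \<in> line_classes. X \<subseteq> L}"
    and "?pencil t \<in> {L \<in> line_classes. X \<subseteq> L}" for t
    using line_class_in[OF pencil_not_in_rad[OF bases]]
      line_class_in[OF not_in_rad_left[OF dots(5)]] zero_in_N dots
    unfolding x(2) by (simp_all add: point_class_subset_line_class_iff dot_simps)
  ultimately have "{L \<in> line_classes. X \<subseteq> L} = insert (line_class b) (?pencil ` T)" by blast
  moreover have "inj_on ?pencil T"
  proof (rule inj_onI)
    fix t t' assume "t \<in> T" "t' \<in> T" "?pencil t = ?pencil t'"
    then show "t = t'"
      using T line_class_pencil_eqD[OF bases] zero_in_N by (metis diff_self)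
  qed
  moreover have "line_class b \<notin> ?pencil ` T" using line_class_pencil_neq[OF bases] by blast
  ultimately show ?thesis using card_T by (simp add: card_image)
qed

lemma line_class_join:
  assumes "X \<in> point_classes" "Y \<in> point_classes" "X \<noteq> Y"
  shows "\<exists>!L. L \<in> line_classes \<and> X \<subseteq> L \<and> Y \<subseteq> L"
proof -
  obtain x where x: "\<not> in_rad x" "X = point_class x" using point_classesE[OF assms(1)] .
  obtain y where y: "\<not> in_rad y" "Y = point_class y" using point_classesE[OF assms(2)] .
  have "y \<notin> point_class x" using point_class_eqI[OF y(1)] assms(3) x y by blast
  then obtain z a b c where bases: "dual_bases x y z a b c"
    using dual_bases_ex_column[OF x(1)] by blast
  note dots = dual_bases_dots[OF bases]
  show ?thesis
  proof (rule ex1I[of _ "line_class c"])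
    show "line_class c \<in> line_classes \<and> X \<subseteq> line_class c \<and> Y \<subseteq> line_class c"
      unfolding x(2) y(2) point_class_subset_line_class_iff
      using line_class_in[OF not_in_rad_left[OF dots(9)]] dots(7,8) zero_in_N by simp
    fix L assume "L \<in> line_classes \<and> X \<subseteq> L \<and> Y \<subseteq> L"
    then obtain m where "\<not> in_rad m" "L = line_class m" "dot m x \<in> N" "dot m y \<in> N"
      unfolding x(2) y(2) by (metis line_classesE point_class_subset_line_class_iff)
    then show "L = line_class c" using line_class_eq_third(1)[OF bases] by blast
  qed
qed

lemma line_class_meet:
  assumes "L \<in> line_classes" "L' \<in> line_classes"
  shows "\<exists>X\<in>point_classes. X \<subseteq> L \<and> X \<subseteq> L'"
proof -
  obtain m where m: "\<not> in_rad m" "L = line_class m" using line_classesE[OF assms(1)] .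
  obtain m' where m': "\<not> in_rad m'" "L' = line_class m'" using line_classesE[OF assms(2)] .
  obtain x y z a b where bases: "dual_bases x y z a b m" using dual_bases_ex_for_row[OF m(1)] .
  note dots = dual_bases_dots[OF bases]
  have "\<exists>v. \<not> in_rad v \<and> dot m v \<in> N \<and> dot m' v \<in> N"
  proof (cases "dot m' x \<in> N")
    case True
    then show ?thesis
      using not_in_rad_right[OF dots(1)] dots(7) zero_in_N by (intro exI[of _ x]) simp
  next
    case False
    let ?v = "y - vsmul x (unit_inv (dot m' x) * dot m' y)"
    have "\<not> in_rad ?v" by (rule not_in_rad_right[of b]) (simp add: dot_simps dots)
    moreover have "dot m ?v = 0" "dot m' ?v = 0"
      by (simp_all add: dot_simps dots unit_inv_right_assoc[OF False])
    ultimately show ?thesis using zero_in_N by (intro exI[of _ ?v]) simp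
  qed
  then obtain v where "\<not> in_rad v" "dot m v \<in> N" "dot m' v \<in> N" by blast
  then show ?thesis
    unfolding m(2) m'(2) using point_class_in[of v] point_class_subset_line_class_iff by blast
qed

lemma point_class_off_line_class:
  assumes "L \<in> line_classes"
  shows "\<exists>X\<in>point_classes. \<not> X \<subseteq> L"
proof -
  obtain m where m: "\<not> in_rad m" "L = line_class m" using line_classesE[OF assms] .
  obtain z where z: "dot m z = 1" using dual_bases_ex_for_row[OF m(1)] dual_bases_dots(9) by metis
  then have "\<not> point_class z \<subseteq> L"
    unfolding m(2) point_class_subset_line_class_iff using one_notin_N by simp
  then show ?thesis using point_class_in[OF not_in_rad_right[OF z]] by blast
qed

lemma dual_bases_ex_flag:
  assumes "\<not> in_rad x" "L \<in> line_classes" "point_class x \<subseteq> L"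
  obtains y z a b c where "dual_bases x y z a b c" "line_class c = L"
proof -
  obtain m where m: "\<not> in_rad m" "L = line_class m" "dot m x \<in> N"
    by (rule line_classes_throughE[OF assms(2,3)])
  obtain y z a b where bases: "dual_bases x y z a b (m - lsmul (dot m x) a)"
    by (rule dual_bases_ex_row[OF assms(1) m(1,3)])
  have "in_rad (m - lsmul 1 (m - lsmul (dot m x) a))"
    using m(3) by (simp add: smul_simps in_rad_lsmul_N)
  from line_class_eqI[OF this one_notin_N] show ?thesis using that[OF bases] m(2) by simp
qed

lemma card_lines_of_through:
  assumes "L \<in> line_classes" "P \<in> hpoints" "class_of P \<subseteq> L"
  shows "card {l \<in> lines_of L. P \<subseteq> l} = card N"
proof -
  obtain x where x: "\<not> in_rad x" "P = point x" using hpointsE[OF assms(2)] .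
  obtain y z a b c where bases: "dual_bases x y z a b c" and c_class: "line_class c = L"
    using dual_bases_ex_flag[OF x(1) assms(1)] assms(3) unfolding x(2) class_of_point .
  note dots = dual_bases_dots[OF bases]
  let ?pencil = "\<lambda>n. line (c + lsmul n b)"
  have "{l \<in> lines_of L. P \<subseteq> l} = ?pencil ` N"
  proof
    have "?pencil n \<in> {l \<in> lines_of L. P \<subseteq> l}" if "n \<in> N" for n
    proof -
      have "line_class (c + lsmul n b) = L"
        unfolding c_class[symmetric] using that
        by (intro line_class_eqI[OF _ one_notin_N]) (simp add: smul_simps in_rad_lsmul_N)
      moreover have "point x \<subseteq> ?pencil n"
        unfolding point_subset_line_iff by (simp add: dot_simps dots)
      ultimately show ?thesis
        using pencil_not_in_rad[OF bases] unfolding lines_of_def x(2) by blast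
    qed
    then show "?pencil ` N \<subseteq> {l \<in> lines_of L. P \<subseteq> l}" by blast
    show "{l \<in> lines_of L. P \<subseteq> l} \<subseteq> ?pencil ` N"
    proof
      fix l assume "l \<in> {l \<in> lines_of L. P \<subseteq> l}"
      then obtain m where m: "\<not> in_rad m" "line_class m = L" "l = line m" "dot m x = 0"
        unfolding x(2) using lines_of_throughE by blast
      have "y \<in> line_class c" unfolding line_class_def using dots zero_in_N by simp
      then have "y \<in> line_class m" using c_class m(2) by simp
      then have my_in_N: "dot m y \<in> N" unfolding line_class_def by blast
      have "dot m z \<notin> N" using line_class_eq_third(2)[OF bases m(1)] m(4) my_in_N zero_in_N by simp
      then show "l \<in> ?pencil ` N"
        using line_in_pencil[OF bases m(4)] m(3) N_mult_left[OF my_in_N] by blast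
    qed
  qed
  moreover have "inj_on ?pencil N" using line_pencil_eqD[OF bases] by (rule inj_onI)
  ultimately show ?thesis by (simp add: card_image)
qed

lemma line_join:
  assumes "L \<in> line_classes" "P \<in> hpoints" "P' \<in> hpoints"
    and "class_of P \<subseteq> L" "class_of P' \<subseteq> L" "class_of P \<noteq> class_of P'"
  shows "\<exists>!l. l \<in> lines_of L \<and> P \<subseteq> l \<and> P' \<subseteq> l"
proof -
  obtain x where x: "\<not> in_rad x" "P = point x" using hpointsE[OF assms(2)] .
  obtain y where y: "\<not> in_rad y" "P' = point y" using hpointsE[OF assms(3)] .
  have "y \<notin> point_class x"
    using point_class_eqI[OF y(1)] assms(6) unfolding x y class_of_point by blast
  then obtain z a b c where bases: "dual_bases x y z a b c"
    using dual_bases_ex_column[OF x(1)] by blast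
  note dots = dual_bases_dots[OF bases]
  obtain m where m: "\<not> in_rad m" "L = line_class m" using line_classesE[OF assms(1)] .
  have "dot m x \<in> N" "dot m y \<in> N"
    using assms(4,5) unfolding m(2) x(2) y(2) class_of_point point_class_subset_line_class_iff
    by auto
  then have c_class: "line_class c = L" using line_class_eq_third(1)[OF bases m(1)] m(2) by simp
  show ?thesis
  proof (rule ex1I[of _ "line c"])
    show "line c \<in> lines_of L \<and> P \<subseteq> line c \<and> P' \<subseteq> line c"
      unfolding x(2) y(2) point_subset_line_iff lines_of_def
      using not_in_rad_left[OF dots(9)] c_class dots by blast
    fix l assume "l \<in> lines_of L \<and> P \<subseteq> l \<and> P' \<subseteq> l"
    then obtain k where "\<not> in_rad k" "l = line k" "dot k x = 0" "dot k y = 0"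
      unfolding x(2) y(2) by (metis lines_ofE point_subset_line_iff)
    then show "l = line c" using line_eq_third[OF bases] by blast
  qed
qed

lemma line_meet:
  assumes "l \<in> lines_of L" "l' \<in> lines_of L"
  shows "\<exists>P\<in>hpoints. P \<subseteq> l \<and> P \<subseteq> l'"
proof -
  obtain m where m: "\<not> in_rad m" "l = line m" "line_class m = L" using lines_ofE[OF assms(1)] .
  obtain m' where m': "l' = line m'" "line_class m' = L" using lines_ofE[OF assms(2)] .
  obtain x y z a b where bases: "dual_bases x y z a b m" using dual_bases_ex_for_row[OF m(1)] .
  note dots = dual_bases_dots[OF bases]
  have "\<exists>v. \<not> in_rad v \<and> dot m v = 0 \<and> dot m' v = 0"
  proof (cases "dot m' x = 0")
    case True
    then show ?thesis using dots(7) not_in_rad_right[OF dots(1)] by blast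
  next
    case False
    have "x \<in> line_class m" "y \<in> line_class m"
      unfolding line_class_def using dots zero_in_N by auto
    then have "x \<in> line_class m'" "y \<in> line_class m'" using m(3) m'(2) by simp_all
    then have "dot m' x \<in> N" "dot m' y \<in> N" unfolding line_class_def by simp_all
    then obtain r where r: "dot m' y = dot m' x * r" using N_generated_right False by blast
    have "\<not> in_rad (y - vsmul x r)" by (rule not_in_rad_right[of b]) (simp add: dot_simps dots)
    moreover have "dot m (y - vsmul x r) = 0" "dot m' (y - vsmul x r) = 0"
      using r by (simp_all add: dot_simps dots)
    ultimately show ?thesis by blast
  qed
  then obtain v where "\<not> in_rad v" "dot m v = 0" "dot m' v = 0" by blast
  then show ?thesis
    unfolding m(2) m'(1) using point_in_hpoints[of v] point_subset_line_iff by blast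
qed

lemma line_meets_class:
  assumes "l \<in> lines_of L" "X \<in> point_classes" "X \<subseteq> L"
  shows "\<exists>P\<in>hpoints. class_of P = X \<and> P \<subseteq> l"
proof -
  obtain m where m: "\<not> in_rad m" "l = line m" "line_class m = L" using lines_ofE[OF assms(1)] .
  obtain x where x: "\<not> in_rad x" "X = point_class x" using point_classesE[OF assms(2)] .
  have mx_in_N: "dot m x \<in> N"
    using assms(3) unfolding x(2) m(3)[symmetric] point_class_subset_line_class_iff .
  obtain z where z: "dot m z = 1" using dual_bases_ex_for_row[OF m(1)] dual_bases_dots(9) by metis
  let ?n = "vsmul z (- dot m x)"
  have n: "in_rad ?n" using mx_in_N by (intro in_rad_vsmul_N N_uminus)
  have "point (x + ?n) \<subseteq> l" unfolding m(2) point_subset_line_iff by (simp add: dot_simps z)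
  then show ?thesis using point_in_hpoints neighbour_translate[OF x(1) n] x(2) by blast
qed

lemma neighbour_point:
  assumes "P \<in> hpoints" "class_of P = point_class x"
  obtains n where "in_rad n" "P = point (x + n)"
proof -
  obtain y where y: "\<not> in_rad y" "P = point y" using hpointsE[OF assms(1)] .
  have "y \<in> point_class x"
    using assms(2) self_in_point_class[of y] unfolding y class_of_point by simp
  then obtain r where r: "r \<notin> N" "in_rad (y - vsmul x r)"
    using unit_scalar_of_neighbour[OF y(1)] by blast
  have "vsmul y (unit_inv r) = x + vsmul (y - vsmul x r) (unit_inv r)"
    by (simp add: smul_simps unit_inv_right[OF r(1)])
  then have "P = point (x + vsmul (y - vsmul x r) (unit_inv r))"
    using point_vsmul[OF unit_inv_notin_N[OF r(1)], of y] y(2) by simp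
  then show ?thesis using that in_rad_vsmul[OF r(2)] by blast
qed

lemma segment_transfer:
  assumes "l \<in> lines_of L" "l' \<in> lines_of L" "P \<in> hpoints" "P' \<in> hpoints"
    and "class_of P = class_of P'" "P \<subseteq> l" "P' \<subseteq> l" "P \<subseteq> l'"
  shows "P' \<subseteq> l'"
proof -
  obtain x where x: "P = point x" using hpointsE[OF assms(3)] .
  obtain n where n: "in_rad n" "P' = point (x + n)"
    using neighbour_point[OF assms(4)] assms(5) unfolding x class_of_point by metis
  obtain m where m: "\<not> in_rad m" "l = line m" "line_class m = L" using lines_ofE[OF assms(1)] .
  obtain m' where m': "\<not> in_rad m'" "l' = line m'" "line_class m' = L"
    using lines_ofE[OF assms(2)] .
  have zeros: "dot m x = 0" "dot m (x + n) = 0" "dot m' x = 0"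
    using assms(6-8) unfolding x n(2) m(2) m'(2) point_subset_line_iff by auto
  then have "dot m n = 0" by (simp add: dot_simps)
  then have "dot m' n = 0" using dot_rad_eq_0_cong[OF m(1) m'(1) _ n(1)] m(3) m'(3) by simp
  then show ?thesis
    unfolding n(2) m'(2) point_subset_line_iff using zeros by (simp add: dot_simps)
qed

lemma neighbour_row_ex:
  assumes bases: "dual_bases x y z a b c" and n: "in_rad n" "dot b n \<noteq> 0"
  obtains k where "\<not> in_rad k" "dot k x = 0" "dot k n = 0"
    "\<And>m. \<lbrakk>\<not> in_rad m; dot m x = 0; dot m n = 0\<rbrakk> \<Longrightarrow> line_class m = line_class k"
proof -
  note dots = dual_bases_dots[OF bases]
  obtain r where r: "dot c n = r * dot b n"
    using N_generated_left[OF dot_in_N_right[OF n(1)] n(2) dot_in_N_right[OF n(1)]] by blast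
  let ?k = "c - lsmul r b"
  have "line_class m = line_class ?k" if m: "\<not> in_rad m" "dot m x = 0" "dot m n = 0" for m
  proof (rule line_class_eqI)
    have "dot m n = (dot m y + dot m z * r) * dot b n"
      using arg_cong[OF dual_bases_row_expansion[OF bases, of m], of "\<lambda>t. dot t n"] m(2) r
      by (simp add: dot_simps algebra_simps)
    then have sum_in_N: "dot m y + dot m z * r \<in> N" using in_N_if_mult_eq_0_left m(3) n(2) by metis
    have "m - lsmul (dot m z) ?k = lsmul (dot m y + dot m z * r) b"
      using dual_bases_row_expansion[OF bases, of m] m(2) by (simp add: smul_simps algebra_simps)
    then show "in_rad (m - lsmul (dot m z) ?k)" using in_rad_lsmul_N[OF sum_in_N] by simp
    show "dot m z \<notin> N"
    proof
      assume mz_in_N: "dot m z \<in> N"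
      then have "dot m y \<in> N" using N_diff[OF sum_in_N N_mult_right[OF mz_in_N, of r]] by simp
      then show False using line_class_eq_third(2)[OF bases m(1)] m(2) mz_in_N zero_in_N by simp
    qed
  qed
  moreover have "\<not> in_rad ?k" by (rule not_in_rad_left[of _ z]) (simp add: dot_simps dots)
  moreover have "dot ?k x = 0" "dot ?k n = 0" using r by (simp_all add: dot_simps dots)
  ultimately show ?thesis by (rule that[rotated -1])
qed

lemma unique_direction:
  assumes "P \<in> hpoints" "P' \<in> hpoints" "class_of P = class_of P'" "P \<noteq> P'"
  shows "\<exists>!L. L \<in> line_classes \<and> (\<exists>l\<in>lines_of L. P \<subseteq> l \<and> P' \<subseteq> l)"
proof -
  obtain x where x: "\<not> in_rad x" "P = point x" using hpointsE[OF assms(1)] .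
  obtain n where n: "in_rad n" "P' = point (x + n)"
    using neighbour_point[OF assms(2)] assms(3) unfolding x class_of_point by metis
  obtain y z a b c where bases: "dual_bases x y z a b c" using dual_bases_ex[OF x(1)] .
  have "dot b n \<noteq> 0 \<or> dot c n \<noteq> 0"
  proof (rule ccontr)
    assume "\<not> ?thesis"
    then have "x + n = vsmul x (1 + dot a n)"
      using dual_bases_column_expansion[OF bases, of n] by (simp add: smul_simps)
    moreover have "1 + dot a n \<notin> N"
      using N_cong[of "1 + dot a n" 1] dot_in_N_right[OF n(1)] one_notin_N by simp
    ultimately show False using point_vsmul assms(4) x n by metis
  qed
  then obtain k where k: "\<not> in_rad k" "dot k x = 0" "dot k n = 0"
    and unique: "\<And>m. \<lbrakk>\<not> in_rad m; dot m x = 0; dot m n = 0\<rbrakk> \<Longrightarrow> line_class m = line_class k"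
    using neighbour_row_ex[OF bases n(1)] neighbour_row_ex[OF dual_bases_swap[OF bases] n(1)]
    by metis
  show ?thesis
  proof (rule ex1I[of _ "line_class k"])
    have "line k \<in> lines_of (line_class k)" by (rule line_in_lines_of[OF k(1)])
    moreover have "P \<subseteq> line k" "P' \<subseteq> line k"
      unfolding x(2) n(2) point_subset_line_iff using k by (auto simp: dot_simps)
    ultimately show "line_class k \<in> line_classes \<and> (\<exists>l\<in>lines_of (line_class k). P \<subseteq> l \<and> P' \<subseteq> l)"
      using line_class_in[OF k(1)] by blast
    fix L assume "L \<in> line_classes \<and> (\<exists>l\<in>lines_of L. P \<subseteq> l \<and> P' \<subseteq> l)"
    then obtain m where "\<not> in_rad m" "line_class m = L" "dot m x = 0" "dot m (x + n) = 0"
      unfolding x(2) n(2) by (metis lines_ofE point_subset_line_iff)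
    then show "L = line_class k" using unique[of m] by (simp add: dot_simps)
  qed
qed

sublocale phg: hjelmslev_plane point_classes line_classes "(\<subseteq>)" "card N"
  hpoints class_of lines_of "(\<subseteq>)"
proof
  have "\<not> in_rad (1, 0, 0)" using one_notin_N unfolding in_rad_def by simp
  then show "point_classes \<noteq> {}" using point_class_in by blast
  show "card {L \<in> line_classes. X \<subseteq> L} = card N + 1" if "X \<in> point_classes" for X
    by (rule card_line_classes_through[OF that])
  show "\<exists>!L. L \<in> line_classes \<and> X \<subseteq> L \<and> Y \<subseteq> L"
    if "X \<in> point_classes" "Y \<in> point_classes" "X \<noteq> Y" for X Y
    by (rule line_class_join[OF that])
  show "class_of ` hpoints = point_classes" by (rule class_of_image)
  show "class_of P \<subseteq> L"
    if L: "L \<in> line_classes" "l \<in> lines_of L" and P: "P \<in> hpoints" "P \<subseteq> l" for L l P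
  proof -
    obtain x where x: "P = point x" using hpointsE[OF P(1)] .
    obtain m where m: "l = line m" "line_class m = L" using L unfolding lines_of_def by blast
    have "dot m x = 0" using P(2) unfolding x m(1) point_subset_line_iff .
    then show ?thesis
      unfolding x m(2)[symmetric] class_of_point point_class_subset_line_class_iff
      using zero_in_N by simp
  qed
qed (rule finite | (rule line_class_meet point_class_off_line_class card_lines_of_through line_join
    line_meet line_meets_class segment_transfer unique_direction; assumption))+

subsection \<open>Parallelograms with parallel diagonals\<close>

lemma same_segment_dot_eq:
  assumes "in_rad s" "in_rad t" "phg.same_segment L (point (x + s)) (point (x + t))"
    and m: "\<not> in_rad m" "line_class m = L"
  shows "dot m s = dot m t"
proof -
  obtain k where k: "\<not> in_rad k" "line_class k = L" "dot k (x + s) = 0" "dot k (x + t) = 0"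
    using assms(3) unfolding phg.same_segment_def by (metis lines_ofE point_subset_line_iff)
  then have "dot k ((x + s) - (x + t)) = 0" unfolding dot_diff_right by simp
  then have "dot k (s - t) = 0" by simp
  then have "dot m (s - t) = 0"
    using dot_rad_eq_0_cong[OF k(1) m(1) _ in_rad_diff[OF assms(1,2)]] k(2) m(2) by simp
  then show ?thesis by (simp add: dot_simps)
qed

lemma point_add_rad_eq:
  assumes "\<not> in_rad x" "in_rad n"
    and "\<not> in_rad k" "dot k x = 0" "dot k n = 0" and "\<not> in_rad m" "dot m x = 0" "dot m n = 0"
    and "line_class k \<noteq> line_class m"
  shows "point (x + n) = point x"
proof (rule ccontr)
  assume neq: "point (x + n) \<noteq> point x"
  note translate = neighbour_translate[OF assms(1,2)]
  have "\<exists>!L. L \<in> line_classes \<and> (\<exists>l\<in>lines_of L. point x \<subseteq> l \<and> point (x + n) \<subseteq> l)"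
    using neq point_in_hpoints[OF assms(1)] point_in_hpoints[OF translate(1)] translate(2)
    by (intro unique_direction) (simp_all add: class_of_point)
  moreover have "point x \<subseteq> line k" "point (x + n) \<subseteq> line k"
    "point x \<subseteq> line m" "point (x + n) \<subseteq> line m"
    unfolding point_subset_line_iff using assms by (simp_all add: dot_simps)
  ultimately show False
    using line_class_in[OF assms(3)] line_class_in[OF assms(6)] line_in_lines_of[OF assms(3)]
      line_in_lines_of[OF assms(6)] assms(9) by blast
qed

text \<open>With \<^term>\<open>point x\<close> as a vertex of a parallelogram, the opposite vertex is the sum of the
  two neighbouring ones, and parallel diagonals force twice a side to vanish.\<close>

lemma parallel_diagonals_degenerate:
  assumes "odd (card N)" "\<not> in_rad x" "in_rad b" "in_rad c" "in_rad d"
    and l: "\<not> in_rad l" "dot l x = 0" "dot l b = 0" "dot l c = dot l d"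
    and m: "\<not> in_rad m" "dot m x = 0" "dot m c = 0" "dot m b = dot m d"
    and h: "\<not> in_rad h" "dot h x = 0" "dot h d = 0" "dot h b = dot h c"
    and neq: "line_class l \<noteq> line_class m" "line_class m \<noteq> line_class h"
  shows "point (x + c) = point x"
proof -
  have "point (x + (d - b - c)) = point x"
    by (rule point_add_rad_eq[OF assms(2) _ l(1,2) _ m(1,2) _ neq(1)])
      (use assms(3-5) l m in \<open>simp_all add: dot_simps in_rad_diff\<close>)
  then have "dot h (x + (d - b - c)) = 0" using h(2) point_subset_line_iff by metis
  moreover have "dot h (x + (d - b - c)) = - (dot h c * (1 + 1))"
    using h(2-4) by (simp add: dot_simps distrib_left del: one_add_one)
  ultimately have "dot h c * (1 + 1) = 0" by (simp only: neg_equal_0_iff_equal)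
  then have "dot h c = 0" using in_N_if_mult_eq_0_right two_notin_N[OF assms(1)] by blast
  then show ?thesis by (rule point_add_rad_eq[OF assms(2,4) m(1-3) h(1,2) _ neq(2)])
qed

lemma row_through_point:
  assumes "phg.same_segment L (point x) P"
  obtains m where "\<not> in_rad m" "line_class m = L" "dot m x = 0"
  using assms unfolding phg.same_segment_def by (metis lines_of_throughE)

lemma fano_free_if_odd:
  assumes "odd (card N)"
  shows phg.fano_free
  unfolding phg.fano_free_def
proof (intro notI, elim bexE)
  fix L M H A B C D
  assume points: "A \<in> hpoints" "B \<in> hpoints" "C \<in> hpoints" "D \<in> hpoints"
    and fano: "fano_quadrangle phg.same_segment L M H A B C D"
  obtain x where x: "\<not> in_rad x" "A = point x" using hpointsE[OF points(1)] .
  have segments: "phg.same_segment L A B" "phg.same_segment L C D" "phg.same_segment M A C"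
      "phg.same_segment M B D" "phg.same_segment H A D" "phg.same_segment H B C"
    and neqs: "A \<noteq> C" "L \<noteq> M" "M \<noteq> H"
    using fano unfolding fano_quadrangle_def by auto
  have classes: "class_of B = point_class x" "class_of C = point_class x"
      "class_of D = point_class x"
    using segments(1,3,5) class_of_point x(2) unfolding phg.same_segment_def by auto
  obtain b where b: "in_rad b" "B = point (x + b)"
    using neighbour_point[OF points(2) classes(1)] .
  obtain c where c: "in_rad c" "C = point (x + c)"
    using neighbour_point[OF points(3) classes(2)] .
  obtain d where d: "in_rad d" "D = point (x + d)"
    using neighbour_point[OF points(4) classes(3)] .
  have A_eq: "A = point (x + 0)" using x(2) by simp
  obtain l where l: "\<not> in_rad l" "line_class l = L" "dot l x = 0"
    using row_through_point segments(1) unfolding x(2) .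
  obtain m where m: "\<not> in_rad m" "line_class m = M" "dot m x = 0"
    using row_through_point segments(3) unfolding x(2) .
  obtain h where h: "\<not> in_rad h" "line_class h = H" "dot h x = 0"
    using row_through_point segments(5) unfolding x(2) .
  note parallel = segments[unfolded A_eq b(2) c(2) d(2), THEN same_segment_dot_eq[rotated 2]]
  have "dot l b = 0" "dot l c = dot l d" "dot m c = 0" "dot m b = dot m d"
    "dot h d = 0" "dot h b = dot h c"
    using parallel(1)[OF l(1,2) in_rad_zero b(1)] parallel(2)[OF l(1,2) c(1) d(1)]
      parallel(3)[OF m(1,2) in_rad_zero c(1)] parallel(4)[OF m(1,2) b(1) d(1)]
      parallel(5)[OF h(1,2) in_rad_zero d(1)] parallel(6)[OF h(1,2) b(1) c(1)]
    by (simp_all add: dot_zero_right)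
  then have "point (x + c) = point x"
    using parallel_diagonals_degenerate[OF assms x(1) b(1) c(1) d(1)] l m h neqs(2,3) by blast
  then show False using neqs(1) x(2) c(2) by simp
qed

subsection \<open>Arcs\<close>

lemma hjelmslev_arc_if_proj_arc:
  assumes "proj_arc K n"
  shows "hjelmslev_arc point_classes line_classes (\<subseteq>) (card N) hpoints class_of lines_of (\<subseteq>) K n"
proof unfold_locales
  show "K \<subseteq> hpoints" using assms unfolding proj_arc_def by blast
  show "card {P \<in> K. P \<subseteq> l} \<le> n" if "l \<in> lines_of L" for L l
  proof -
    have "l \<in> hlines" using that line_in_hlines unfolding lines_of_def by blast
    then show ?thesis using assms unfolding proj_arc_def by blast
  qed
qed

lemma card_proj_arc_le:
  assumes "proj_arc (K :: 'r vec3 set set) 3" "card N \<ge> 5"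
  shows "card K + (if odd (card N) then 2 * card N else card N) \<le> 2 * (card N)^2 + 4"
proof -
  interpret hjelmslev_three_arc point_classes line_classes "(\<subseteq>)" "card N"
    hpoints class_of lines_of "(\<subseteq>)" K
    by (intro hjelmslev_three_arc.intro hjelmslev_arc_if_proj_arc assms(1))
  show ?thesis using card_arc_le[OF assms(2)] fano_free_if_odd by simp
qed

end

lemma m_arc_le:
  assumes "\<And>K :: ('r::{ring_1,finite} vec3 set) set. proj_arc K n \<Longrightarrow> card K \<le> k"
  shows "m_arc n TYPE('r) \<le> k"
proof -
  have "proj_arc ({} :: ('r vec3 set) set) n" by (simp add: proj_arc_def)
  then have "{card K | K. proj_arc (K :: ('r vec3 set) set) n} \<noteq> {}" by blast
  moreover have "finite {card K | K. proj_arc (K :: ('r vec3 set) set) n}" by simp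
  ultimately show ?thesis
    unfolding m_arc_def using assms by (intro Max.boundedI) auto
qed

theorem theorem4p12:
  fixes N :: "'r::{ring_1,finite} set" and q :: nat
  assumes "chain_ring2 N"
    and "card (UNIV :: 'r set) = q * card N"
    and "q \<ge> 5"
  shows "m_arc 3 TYPE('r) \<le> (if odd q then 2 * q^2 - 2 * q + 4 else 2 * q^2 - q + 4)"
proof (rule m_arc_le)
  interpret chain_ring N by unfold_locales (fact assms(1))
  have "card N * card N = q * card N" using card_UNIV_eq assms(2) by metis
  then have q: "card N = q" using card_N_pos by (metis mult_right_cancel less_not_refl)
  fix K :: "('r vec3 set) set"
  assume "proj_arc K 3"
  then have "card K + (if odd q then 2 * q else q) \<le> 2 * q^2 + 4"
    using card_proj_arc_le assms(3) unfolding q by blast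
  then show "card K \<le> (if odd q then 2 * q^2 - 2 * q + 4 else 2 * q^2 - q + 4)"
    by (auto split: if_splits)
qed

end
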